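(* Assume (H1) and (H2), and $I_T(0,0)>0$ for some $T>0$. Then for any $q,q'\in\mathcal R$, \[\lim_{\delta\to0}\limsup_{n\to\infty}\sup_{z\in E:|z-nq|<\delta n}\frac1n\log G\bigl(z,nB(q',\delta)\bigr)\ \le\ -\hat I(q,q').\]
   Context: Let $E\subset\mathbb R^d$ be unbounded and $(Z(t))_{t\ge0}$ a continuous-time strong Markov process on $E$ with right-continuous paths having left limits; $\mathbb P_z,\mathbb E_z$ denote probability and expectation given $Z(0)=z$. $G(z,B)=\int_0^\infty\mathbb P_z(Z(t)\in B)\,dt$, assumed finite for $z\in E$ and compact $B$. $Z^\varepsilon(t)=\varepsilon Z(t/\varepsilon)$. For $B\subset\mathbb R^d$ and $n>0$, $nB=\{nx:x\in B\}$; $B(x,r)$ is the open ball of center $x$ and radius $r$. (H1): for every $T>0$, the family $Z^\varepsilon(T)$ satisfies the weak LDP with a good rate function $I_T:\mathbb R^d\times\mathbb R^d\to[0,\infty]$, i.e. $I_T$ is lower semicontinuous; for every $q\in\mathbb R^d$ and open $O$, $\lim_{\delta\to0}\liminf_{\varepsilon\to0}\varepsilon\log\inf_{z\in E:|\varepsilon z-q|<\delta}\mathbb P_z(Z^\varepsilon(T)\in O)\ge-\inf_{q'\in O}I_T(q,q')$; and for every $q$ and compact $V$, $\lim_{\delta\to0}\limsup_{\varepsilon\to0}\varepsilon\log\sup_{z\in E:|\varepsilon z-q|<\delta}\mathbb P_z(Z^\varepsilon(T)\in V)\le-\inf_{q'\in V}I_T(q,q')$. (H2): $\hat\varphi(a)=\sup_{z\in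 E}\sup_{t\in[0,1]}\mathbb E_z(e^{a\cdot(Z(t)-z)})<\infty$ for every $a\in\mathbb R^d$. $\mathcal R$ is the set of all limits $\lim_{\varepsilon\to0}\varepsilon z_\varepsilon$ with $z_\varepsilon\in E$. $I(q,q')=\inf_{T>0}I_T(q,q')$; $\hat I(q,q')=I(q,q')$ if $q\ne q'$ and $\hat I(q,q)=0$. *)

theory Defs
  imports "HOL-Probability.Probability"
begin

text \<open>Lower semicontinuity of an extended-nonnegative-valued function (standard definition).\<close>
definition lsc :: "('b::topological_space \<Rightarrow> ennreal) \<Rightarrow> bool" where
  "lsc f \<longleftrightarrow> (\<forall>x. \<forall>c. c < f x \<longrightarrow> (\<forall>\<^sub>F y in nhds x. c < f y))"

text \<open>Natural filtration of the process Z on the sample space given by N.\<close>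
definition nat_filt :: "'w measure \<Rightarrow> (real \<Rightarrow> 'w \<Rightarrow> 'a::euclidean_space) \<Rightarrow> real \<Rightarrow> 'w set set" where
  "nat_filt N Z t = sets (sigma (space N)
      (\<Union>s\<in>{0..t}. {Z s -` B \<inter> space N | B. B \<in> sets borel}))"

text \<open>Its right-continuous version F_{t+}.\<close>
definition nat_filt_plus :: "'w measure \<Rightarrow> (real \<Rightarrow> 'w \<Rightarrow> 'a::euclidean_space) \<Rightarrow> real \<Rightarrow> 'w set set" where
  "nat_filt_plus N Z t = (\<Inter>u\<in>{t<..}. nat_filt N Z u)"

text \<open>Stopping times (possibly infinite) w.r.t. the right-continuous natural filtration.\<close>
definition is_stopping_time :: "'w measure \<Rightarrow> (real \<Rightarrow> 'w \<Rightarrow> 'a::euclidean_space) \<Rightarrow> ('w \<Rightarrow> ennreal) \<Rightarrow> bool" where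
  "is_stopping_time N Z \<tau> \<longleftrightarrow>
     (\<forall>t\<ge>0. {\<omega>\<in>space N. \<tau> \<omega> \<le> ennreal t} \<in> nat_filt_plus N Z t)"

text \<open>The sigma-algebra of events prior to the stopping time.\<close>
definition pre_tau :: "'w measure \<Rightarrow> (real \<Rightarrow> 'w \<Rightarrow> 'a::euclidean_space) \<Rightarrow> ('w \<Rightarrow> ennreal) \<Rightarrow> 'w set set" where
  "pre_tau N Z \<tau> = {A \<in> sets N. \<forall>t\<ge>0. A \<inter> {\<omega>\<in>space N. \<tau> \<omega> \<le> ennreal t} \<in> nat_filt_plus N Z t}"

text \<open>
  A continuous-time strong Markov process on E with right-continuous paths having left limits:
  sample space N (only its measurable structure is used), laws P z (= P_z) for starting points
  z in E, process Z t \<omega>.  The strong Markov property is stated for one future time s; applied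
  to the stopping times tau+s it yields the usual finite-dimensional version.
\<close>
definition strong_markov_cadlag ::
  "'a::euclidean_space set \<Rightarrow> 'w measure \<Rightarrow> ('a \<Rightarrow> 'w measure) \<Rightarrow> (real \<Rightarrow> 'w \<Rightarrow> 'a) \<Rightarrow> bool" where
  "strong_markov_cadlag E N P Z \<longleftrightarrow>
     (\<forall>z\<in>E. prob_space (P z) \<and> sets (P z) = sets N) \<and>
     (\<forall>z\<in>E. AE \<omega> in P z. Z 0 \<omega> = z) \<and>
     (\<forall>t\<ge>0. Z t \<in> borel_measurable N) \<and>
     (\<forall>\<omega>\<in>space N. \<forall>t\<ge>0. Z t \<omega> \<in> E) \<and>
     (\<forall>\<omega>\<in>space N. \<forall>t\<ge>0. ((\<lambda>s. Z s \<omega>) \<longlongrightarrow> Z t \<omega>) (at_right t)) \<and>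
     (\<forall>\<omega>\<in>space N. \<forall>t>0. \<exists>l. ((\<lambda>s. Z s \<omega>) \<longlongrightarrow> l) (at_left t)) \<and>
     (\<forall>s\<ge>0. \<forall>B\<in>sets borel.
        (\<lambda>z. emeasure (P z) {\<omega>\<in>space N. Z s \<omega> \<in> B}) \<in> borel_measurable (restrict_space borel E)) \<and>
     (\<forall>z\<in>E. \<forall>\<tau>. is_stopping_time N Z \<tau> \<longrightarrow> (\<forall>A\<in>pre_tau N Z \<tau>. \<forall>s\<ge>0. \<forall>B\<in>sets borel.
        emeasure (P z) {\<omega>\<in>A. \<tau> \<omega> < \<infinity> \<and> Z (enn2real (\<tau> \<omega>) + s) \<omega> \<in> B}
        = (\<integral>\<^sup>+ \<omega>. indicator {\<omega>\<in>A. \<tau> \<omega> < \<infinity>} \<omega> *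
              emeasure (P (Z (enn2real (\<tau> \<omega>)) \<omega>)) {\<omega>'\<in>space N. Z s \<omega>' \<in> B} \<partial>P z)))"

text \<open>Green measure G(z,B) = int_0^infty P_z(Z(t) in B) dt.\<close>
definition green :: "'w measure \<Rightarrow> ('a \<Rightarrow> 'w measure) \<Rightarrow> (real \<Rightarrow> 'w \<Rightarrow> 'a) \<Rightarrow> 'a \<Rightarrow> 'a set \<Rightarrow> ennreal" where
  "green N P Z z B = (\<integral>\<^sup>+ t. indicator {0..} t * emeasure (P z) {\<omega>\<in>space N. Z t \<omega> \<in> B} \<partial>lborel)"

text \<open>Logarithm on [0,infty] with log 0 = -infty, log infty = infty.\<close>
definition elog :: "ennreal \<Rightarrow> ereal" where
  "elog x = (if x = 0 then -\<infinity> else if x = \<infinity> then \<infinity> else ereal (ln (enn2real x)))"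

text \<open>The set R of all limits of eps * z_eps with z_eps in E, as eps -> 0+.\<close>
definition scaling_limits :: "'a::real_normed_vector set \<Rightarrow> 'a set" where
  "scaling_limits E = {q. \<exists>zz::real \<Rightarrow> 'a. (\<forall>\<epsilon>>0. zz \<epsilon> \<in> E) \<and> ((\<lambda>\<epsilon>. \<epsilon> *\<^sub>R zz \<epsilon>) \<longlongrightarrow> q) (at_right 0)}"

text \<open>(H1) weak LDP for Z^eps(T) = eps Z(T/eps), for every T>0.\<close>
definition H1 :: "'a::euclidean_space set \<Rightarrow> 'w measure \<Rightarrow> ('a \<Rightarrow> 'w measure) \<Rightarrow> (real \<Rightarrow> 'w \<Rightarrow> 'a)
                   \<Rightarrow> (real \<Rightarrow> 'a \<Rightarrow> 'a \<Rightarrow> ennreal) \<Rightarrow> bool" where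
  "H1 E N P Z I \<longleftrightarrow> (\<forall>T>0.
     lsc (\<lambda>p. I T (fst p) (snd p)) \<and>
     (\<forall>q U. open U \<longrightarrow>
        Liminf (at_right 0) (\<lambda>\<delta>. Liminf (at_right 0) (\<lambda>\<epsilon>. ereal \<epsilon> *
           elog (INF z\<in>{z\<in>E. norm (\<epsilon> *\<^sub>R z - q) < \<delta>}.
                   emeasure (P z) {\<omega>\<in>space N. \<epsilon> *\<^sub>R Z (T / \<epsilon>) \<omega> \<in> U})))
        \<ge> - enn2ereal (INF q'\<in>U. I T q q')) \<and>
     (\<forall>q V. compact V \<longrightarrow>
        Limsup (at_right 0) (\<lambda>\<delta>. Limsup (at_right 0) (\<lambda>\<epsilon>. ereal \<epsilon> *
           elog (SUP z\<in>{z\<in>E. norm (\<epsilon> *\<^sub>R z - q) < \<delta>}.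
                   emeasure (P z) {\<omega>\<in>space N. \<epsilon> *\<^sub>R Z (T / \<epsilon>) \<omega> \<in> V})))
        \<le> - enn2ereal (INF q'\<in>V. I T q q')))"

text \<open>(H2) uniform exponential moments of increments over times in [0,1].\<close>
definition H2 :: "'a::euclidean_space set \<Rightarrow> ('a \<Rightarrow> 'w measure) \<Rightarrow> (real \<Rightarrow> 'w \<Rightarrow> 'a) \<Rightarrow> bool" where
  "H2 E P Z \<longleftrightarrow> (\<forall>a. (SUP z\<in>E. SUP t\<in>{0..1}. \<integral>\<^sup>+ \<omega>. ennreal (exp (a \<bullet> (Z t \<omega> - z))) \<partial>P z) < \<infinity>)"

definition rateI :: "(real \<Rightarrow> 'a \<Rightarrow> 'a \<Rightarrow> ennreal) \<Rightarrow> 'a \<Rightarrow> 'a \<Rightarrow> ennreal" where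
  "rateI I q q' = (INF T\<in>{0<..}. I T q q')"

definition rateI_hat :: "(real \<Rightarrow> 'a \<Rightarrow> 'a \<Rightarrow> ennreal) \<Rightarrow> 'a \<Rightarrow> 'a \<Rightarrow> ennreal" where
  "rateI_hat I q q' = (if q = q' then 0 else rateI I q q')"

end

theory Submission
  imports Defs "HOL-Probability.Distributions" "HOL-Real_Asymp.Real_Asymp"
begin

(*
  The Green function is the time integral of P_z(Z(t) \<in> n B(q',\<delta>)), which is bounded
  separately in three time regimes, uniformly in starting points z near n q.

  For t \<le> s n with s small, the target is at distance of order n, and Chernoff bounds
  built on the exponential moments of (H2) make this as unlikely as e^{-A n} for any A.

  For s n \<le> t \<le> K n write t = n / l.  The LDP upper bound at time 1 from l q gives
  decay e^{-n I_1(l q, l q') / l}, and the LDP itself forces the scaling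
  I_1(l q, l q') \<ge> l I_{1/l}(q, q') \<ge> l I(q, q'); compactness of l \<in> [1/K, 1/s]
  makes the bound e^{-a n}, a < I(q, q'), uniform.

  For t \<ge> K n, the hypothesis I_T(0,0) > 0 shows that a process started within
  \<kappa> t of the origin is still within \<rho> t of it at time t only with probability e^{-\<beta> t}.

  Integrating, G \<le> e^{-a n} (C K n + 2/\<beta>), so (1/n) log G \<le> -a + o(1).  For q = q'
  the same estimate with a = 0 shows that G grows at most linearly in n.
*)

section \<open>Real-analytic preliminaries\<close>

lemma nn_integral_indicator_exp_neg:
  fixes b :: real assumes b: "b > 0"
  shows "(\<integral>\<^sup>+t. ennreal (indicator {0..} t * exp (-(b*t))) \<partial>lborel) = ennreal (1/b)"
proof -
  have "emeasure (density lborel (exponential_density b)) UNIV = 1"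
    using prob_space.emeasure_space_1[OF prob_space_exponential_density[OF b]] by simp
  then have "(\<integral>\<^sup>+t. ennreal (exponential_density b t) \<partial>lborel) = 1"
    by (subst (asm) emeasure_density) (auto simp: erlang_density_def)
  moreover have "(\<lambda>t. ennreal (exponential_density b t))
      = (\<lambda>t. ennreal b * ennreal (indicator {0..} t * exp (-(b*t))))"
    using b by (auto simp: erlang_density_def fun_eq_iff indicator_def ennreal_mult[symmetric] mult_ac)
  ultimately have "ennreal b * (\<integral>\<^sup>+t. ennreal (indicator {0..} t * exp (-(b*t))) \<partial>lborel) = 1"
    by (subst nn_integral_cmult[symmetric]) auto
  then have "(\<integral>\<^sup>+t. ennreal (indicator {0..} t * exp (-(b*t))) \<partial>lborel) = 1 / ennreal b"
  proof -
    fix X assume "ennreal b * X = 1"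
    moreover have "X = (X * ennreal b) / ennreal b" using b by (simp add: ennreal_mult_divide_eq)
    ultimately show "X = 1 / ennreal b" by (simp add: mult.commute)
  qed
  then show ?thesis using b divide_ennreal[of 1 b] by simp
qed

lemma elog_mono:
  assumes xy: "x \<le> y" shows "elog x \<le> elog y"
proof (cases "x = 0 \<or> y = \<infinity>")
  case False
  then have "x \<noteq> \<infinity>" "y \<noteq> 0" "x \<noteq> 0" "y \<noteq> \<infinity>" using xy by (auto simp: top_unique)
  moreover have "enn2real x \<le> enn2real y" using xy \<open>y \<noteq> \<infinity>\<close> by (simp add: enn2real_mono less_top)
  moreover have "enn2real x > 0" using \<open>x \<noteq> \<infinity>\<close> \<open>x \<noteq> 0\<close>
    by (simp add: enn2real_positive_iff less_top[symmetric] zero_less_iff_neq_zero)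
  ultimately show ?thesis by (simp add: elog_def)
qed (auto simp: elog_def)

lemma ereal_mult_elog_le_iff:
  assumes \<epsilon>: "\<epsilon> > 0"
  shows "ereal \<epsilon> * elog x \<le> ereal c \<longleftrightarrow> x \<le> ennreal (exp (c / \<epsilon>))"
proof (cases x rule: ennreal_cases)
  case (real r)
  show ?thesis
  proof (cases "r = 0")
    case False
    then have "r > 0" using real by simp
    then have "ereal \<epsilon> * elog x \<le> ereal c \<longleftrightarrow> ln r \<le> c / \<epsilon>"
      using real \<epsilon> by (simp add: elog_def pos_le_divide_eq mult.commute)
    also have "\<dots> \<longleftrightarrow> r \<le> exp (c / \<epsilon>)" using \<open>r > 0\<close> ln_le_cancel_iff[of r "exp (c / \<epsilon>)"] by simp
    finally show ?thesis using real by simp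
  qed (use real \<epsilon> in \<open>simp add: elog_def\<close>)
qed (use \<epsilon> in \<open>simp add: elog_def top_unique\<close>)

lemma eventually_ln_affine_div_le:
  fixes A B c :: real assumes "A > 0" "B > 0" "c > 0"
  shows "\<forall>\<^sub>F n in at_top. ln (A + B * n) / n \<le> c"
proof -
  have "((\<lambda>n::real. ln (A + B * n) / n) \<longlongrightarrow> 0) at_top" using assms by real_asymp
  from order_tendstoD(2)[OF this assms(3)] show ?thesis by (rule eventually_mono) simp
qed

lemma ennreal_dense_real:
  fixes x y :: ennreal assumes "x < y"
  obtains r where "0 \<le> r" "x < ennreal r" "ennreal r < y"
proof -
  obtain u where u: "x < u" "u < y" using dense[OF assms] by blast
  then have "u \<noteq> top" using top.not_eq_extremum by fastforce
  then show ?thesis using that u by (cases u rule: ennreal_cases) auto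
qed

lemma eventually_at_right_0_scale:
  fixes l :: real assumes l: "l > 0" and ev: "\<forall>\<^sub>F x in at_right 0. P x"
  shows "\<forall>\<^sub>F x in at_right 0. P (l * x)"
proof -
  obtain b where "b > 0" "\<And>y. 0 < y \<Longrightarrow> y < b \<Longrightarrow> P y" using ev unfolding eventually_at_right_field by auto
  then show ?thesis unfolding eventually_at_right_field
    using l by (intro exI[of _ "b / l"]) (auto simp: field_simps)
qed

lemma eventually_at_right_0_obtain:
  assumes "\<forall>\<^sub>F x in at_right (0::real). P x"
  obtains x where "x > 0" "P x"
proof -
  obtain b where "b > 0" "\<And>y. 0 < y \<Longrightarrow> y < b \<Longrightarrow> P y"
    using assms unfolding eventually_at_right_field by auto
  then show ?thesis using that[of "b / 2"] by simp
qed

lemma Limsup_Limsup_SUP_le: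
  fixes H :: "real \<Rightarrow> real \<Rightarrow> 'b \<Rightarrow> 'c::complete_linorder"
  assumes "\<forall>\<^sub>F \<delta> in at_right 0. \<forall>\<^sub>F n in at_top. \<forall>z\<in>S \<delta> n. H \<delta> n z \<le> c"
  shows "Limsup (at_right 0) (\<lambda>\<delta>. Limsup at_top (\<lambda>n. SUP z\<in>S \<delta> n. H \<delta> n z)) \<le> c"
proof (rule Limsup_bounded)
  show "\<forall>\<^sub>F \<delta> in at_right 0. Limsup at_top (\<lambda>n. SUP z\<in>S \<delta> n. H \<delta> n z) \<le> c"
    using assms by (elim eventually_mono) (intro Limsup_bounded, elim eventually_mono, blast intro: SUP_least)
qed

lemma exists_Basis_abs_inner_ge:
  fixes v :: "'a::euclidean_space"
  assumes "r \<le> norm v"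
  shows "\<exists>i\<in>Basis. r / DIM('a) \<le> \<bar>v \<bullet> i\<bar>"
proof (rule ccontr)
  assume "\<not> ?thesis"
  then have "(\<Sum>i\<in>Basis. \<bar>v \<bullet> i\<bar>) < (\<Sum>i\<in>(Basis::'a set). r / DIM('a))"
    by (intro sum_strict_mono) auto
  then show False using norm_le_l1[of v] assms by simp
qed

lemma emeasure_ge_le_exp_moment:
  fixes g :: "'w \<Rightarrow> real"
  assumes g: "g \<in> borel_measurable M" and \<theta>: "\<theta> \<ge> 0"
  shows "emeasure M {\<omega>\<in>space M. c \<le> g \<omega>}
    \<le> ennreal (exp (-\<theta>*c)) * (\<integral>\<^sup>+\<omega>. ennreal (exp (\<theta> * g \<omega>)) \<partial>M)"
proof -
  have "emeasure M {\<omega>\<in>space M. c \<le> g \<omega>} = (\<integral>\<^sup>+\<omega>. indicator {\<omega>\<in>space M. c \<le> g \<omega>} \<omega> \<partial>M)"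
    using g by simp
  also have "\<dots> \<le> (\<integral>\<^sup>+\<omega>. ennreal (exp (-\<theta>*c)) * ennreal (exp (\<theta> * g \<omega>)) \<partial>M)"
  proof (rule nn_integral_mono)
    fix \<omega>
    have "c \<le> g \<omega> \<Longrightarrow> 0 \<le> -\<theta>*c + \<theta> * g \<omega>"
      using \<theta> by (simp add: algebra_simps mult_left_mono)
    then have "c \<le> g \<omega> \<Longrightarrow> 1 \<le> exp (-\<theta>*c) * exp (\<theta> * g \<omega>)"
      by (simp add: exp_add[symmetric])
    then show "indicator {\<omega>\<in>space M. c \<le> g \<omega>} \<omega> \<le> ennreal (exp (-\<theta>*c)) * ennreal (exp (\<theta> * g \<omega>))"
      by (auto simp: indicator_def ennreal_mult[symmetric])
  qed
  also have "\<dots> = ennreal (exp (-\<theta>*c)) * (\<integral>\<^sup>+\<omega>. ennreal (exp (\<theta> * g \<omega>)) \<partial>M)"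
    by (rule nn_integral_cmult) (use g in measurable)
  finally show ?thesis .
qed

lemma lsc_gt_on_ball:
  fixes I :: "'a::metric_space \<Rightarrow> 'a \<Rightarrow> ennreal"
  assumes "lsc (\<lambda>p. I (fst p) (snd p))" and "c < I q q'"
  obtains d where "d > 0" "\<And>p'. dist p' q' < d \<Longrightarrow> c < I q p'"
proof -
  have "\<forall>\<^sub>F p in nhds (q, q'). c < I (fst p) (snd p)"
    using assms unfolding lsc_def by auto
  then obtain d where "d > 0" "\<And>p. dist p (q, q') < d \<Longrightarrow> c < I (fst p) (snd p)"
    unfolding eventually_nhds_metric by blast
  then show ?thesis using that[of d] by (fastforce simp: dist_Pair_Pair)
qed

lemma power_Suc_ceiling_le:
  fixes \<Phi> t s n :: real
  assumes \<Phi>: "\<Phi> \<ge> 1" and t: "0 \<le> t" "t \<le> s * n" and s: "s * ln \<Phi> \<le> 1" "s > 0" and n: "n > 0"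
  shows "\<Phi> ^ Suc (nat \<lceil>t\<rceil>) \<le> \<Phi>\<^sup>2 * exp n"
proof -
  have "t * ln \<Phi> \<le> (s * n) * ln \<Phi>" using t \<Phi> by (intro mult_right_mono) auto
  also have "\<dots> = (s * ln \<Phi>) * n" by simp
  also have "\<dots> \<le> n" using s n by (simp add: mult_left_le_one_le)
  finally have tn: "t * ln \<Phi> \<le> n" .
  have "\<Phi> ^ Suc (nat \<lceil>t\<rceil>) = \<Phi> powr real (Suc (nat \<lceil>t\<rceil>))"
    using \<Phi> by (rule powr_realpow[symmetric, OF less_le_trans[OF zero_less_one]])
  also have "\<dots> \<le> \<Phi> powr (t + 2)" using \<Phi> t by (intro powr_mono) linarith+
  also have "\<dots> = \<Phi> powr t * \<Phi>\<^sup>2" using \<Phi> by (simp add: powr_add powr_numeral)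
  also have "\<dots> = \<Phi>\<^sup>2 * exp (t * ln \<Phi>)" using \<Phi> by (simp add: powr_def)
  also have "\<dots> \<le> \<Phi>\<^sup>2 * exp n" using tn by (intro mult_left_mono) auto
  finally show ?thesis .
qed

lemma norm_le_of_mem_scaled_ball:
  assumes "x \<in> (\<lambda>x. n *\<^sub>R x) ` ball q' \<delta>" "n \<ge> 0" "\<delta> \<le> 1"
  shows "norm x \<le> n * (norm q' + 1)"
proof -
  obtain y where y: "dist q' y < \<delta>" "x = n *\<^sub>R y" using assms(1) by auto
  have "norm y \<le> norm q' + 1" using y(1) assms(3) norm_triangle_ineq2[of y q']
    by (simp add: dist_norm norm_minus_commute)
  then show ?thesis using y(2) assms(2) by (simp add: mult_left_mono)
qed

lemma norm_less_of_near_scaled: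
  assumes "norm (z - n *\<^sub>R q) < \<delta> * n" "n \<ge> 0" "\<delta> \<le> 1"
  shows "norm z < n * (norm q + 1)"
proof -
  have "norm z \<le> norm (z - n *\<^sub>R q) + norm (n *\<^sub>R q)" using norm_triangle_ineq[of "z - n *\<^sub>R q" "n *\<^sub>R q"] by simp
  also have "\<dots> < \<delta> * n + n * norm q" using assms by simp
  also have "\<dots> \<le> n * (norm q + 1)" using assms mult_right_mono[of \<delta> 1 n] by (simp add: algebra_simps)
  finally show ?thesis .
qed

lemma norm_rescale_diff_le:
  fixes y p :: "'a::real_normed_vector"
  assumes "c > 0"
  shows "norm (c *\<^sub>R y - l *\<^sub>R p) \<le> c * norm (y - n *\<^sub>R p) + \<bar>c * n - l\<bar> * norm p"
proof -
  have "c *\<^sub>R y - l *\<^sub>R p = c *\<^sub>R (y - n *\<^sub>R p) + (c * n - l) *\<^sub>R p" by (simp add: algebra_simps)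
  then show ?thesis using assms norm_triangle_ineq[of "c *\<^sub>R (y - n *\<^sub>R p)" "(c * n - l) *\<^sub>R p"] by simp
qed

lemma green_le_of_piecewise_bound:
  assumes bound: "\<And>t. t \<ge> 0 \<Longrightarrow> emeasure (P z) {\<omega>\<in>space N. Z t \<omega> \<in> A}
      \<le> ennreal (if t \<le> L then a else b * exp (-(g*t)))"
    and L: "L \<ge> 0" and a: "a \<ge> 0" and b: "b \<ge> 0" and g: "g > 0"
  shows "green N P Z z A \<le> ennreal (a*L + b/g)"
proof -
  have "green N P Z z A
      \<le> (\<integral>\<^sup>+t. ennreal a * indicator {0..L} t + ennreal b * ennreal (indicator {0..} t * exp (-(g*t))) \<partial>lborel)"
    unfolding green_def
  proof (rule nn_integral_mono)
    fix t :: real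
    show "indicator {0..} t * emeasure (P z) {\<omega>\<in>space N. Z t \<omega> \<in> A}
        \<le> ennreal a * indicator {0..L} t + ennreal b * ennreal (indicator {0..} t * exp (-(g*t)))"
      using bound[of t] b
      by (cases "t \<le> L") (auto simp: indicator_def ennreal_mult intro: add_increasing add_increasing2)
  qed
  also have "\<dots> = ennreal a * ennreal L + ennreal b * ennreal (1/g)"
    using L by (simp add: nn_integral_add nn_integral_cmult nn_integral_indicator_exp_neg[OF g])
  also have "\<dots> = ennreal (a*L + b/g)"
    using a b L g by (simp add: ennreal_mult[symmetric] ennreal_plus[symmetric] del: ennreal_plus)
  finally show ?thesis .
qed

lemma Limsup_green_le:
  assumes g: "g > 0" and C: "C > 0" and K: "K > 0" and a': "a' < a"
    and bound: "\<forall>\<^sub>F \<delta> in at_right 0. \<forall>\<^sub>F n in at_top. \<forall>z\<in>{z\<in>E. norm (z - n *\<^sub>R q) < \<delta> * n}. \<forall>t\<ge>0.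
        emeasure (P z) {\<omega>\<in>space N. Z t \<omega> \<in> (\<lambda>x. n *\<^sub>R x) ` ball q' \<delta>}
          \<le> ennreal (if t \<le> K * n then C * exp (-(a*n)) else exp (-(a*n)) * exp (-(g*t)))"
  shows "Limsup (at_right 0) (\<lambda>\<delta>::real. Limsup at_top (\<lambda>n::real.
           SUP z\<in>{z\<in>E. norm (z - n *\<^sub>R q) < \<delta> * n}.
             ereal (1 / n) * elog (green N P Z z ((\<lambda>x. n *\<^sub>R x) ` ball q' \<delta>)))) \<le> ereal (-a')"
proof (rule Limsup_Limsup_SUP_le)
  have small: "\<forall>\<^sub>F n in at_top. ln (1/g + (C*K) * n) / n \<le> a - a'"
    using eventually_ln_affine_div_le[of "1/g" "C*K" "a - a'"] g C K a' by simp
  show "\<forall>\<^sub>F \<delta> in at_right 0. \<forall>\<^sub>F n in at_top. \<forall>z\<in>{z\<in>E. norm (z - n *\<^sub>R q) < \<delta> * n}.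
      ereal (1 / n) * elog (green N P Z z ((\<lambda>x. n *\<^sub>R x) ` ball q' \<delta>)) \<le> ereal (-a')"
    using bound
  proof (rule eventually_mono)
    fix \<delta> :: real
    assume "\<forall>\<^sub>F n in at_top. \<forall>z\<in>{z\<in>E. norm (z - n *\<^sub>R q) < \<delta> * n}. \<forall>t\<ge>0.
        emeasure (P z) {\<omega>\<in>space N. Z t \<omega> \<in> (\<lambda>x. n *\<^sub>R x) ` ball q' \<delta>}
          \<le> ennreal (if t \<le> K * n then C * exp (-(a*n)) else exp (-(a*n)) * exp (-(g*t)))"
    with small eventually_gt_at_top[of 0]
    show "\<forall>\<^sub>F n in at_top. \<forall>z\<in>{z\<in>E. norm (z - n *\<^sub>R q) < \<delta> * n}.
        ereal (1 / n) * elog (green N P Z z ((\<lambda>x. n *\<^sub>R x) ` ball q' \<delta>)) \<le> ereal (-a')"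
    proof eventually_elim
      case (elim n)
      have "1/g + C*K*n \<le> exp (ln (1/g + C*K*n))" using g C K elim(2) by (subst exp_ln) (auto intro!: add_pos_nonneg)
      also have "\<dots> \<le> exp ((a - a') * n)" using elim(1,2) by (simp add: field_simps)
      finally have "exp (-(a*n)) * (1/g + C*K*n) \<le> exp (-(a*n)) * exp ((a - a') * n)" by simp
      also have "\<dots> = exp (-(a'*n))" by (simp add: exp_add[symmetric] algebra_simps)
      finally have total: "C * exp (-(a*n)) * (K*n) + exp (-(a*n)) / g \<le> exp (-(a'*n))"
        by (simp add: field_simps)
      show ?case
      proof
        fix z assume "z \<in> {z\<in>E. norm (z - n *\<^sub>R q) < \<delta> * n}"
        then have "green N P Z z ((\<lambda>x. n *\<^sub>R x) ` ball q' \<delta>)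
            \<le> ennreal (C * exp (-(a*n)) * (K*n) + exp (-(a*n)) / g)"
          using elim(2,3) C K g by (intro green_le_of_piecewise_bound) auto
        also have "\<dots> \<le> ennreal (exp (-(a'*n)))" using total by (rule ennreal_leI)
        finally show "ereal (1 / n) * elog (green N P Z z ((\<lambda>x. n *\<^sub>R x) ` ball q' \<delta>)) \<le> ereal (-a')"
          using ereal_mult_elog_le_iff[of "1/n"] elim(2) by simp
      qed
    qed
  qed
qed

lemma norm_diff_ge_of_mem_scaled_ball:
  assumes x: "x \<in> (\<lambda>x. n *\<^sub>R x) ` ball q' \<delta>" and z: "norm (z - n *\<^sub>R q) < \<delta> * n"
    and n: "n \<ge> 0" and \<delta>: "\<delta> \<le> norm (q' - q) / 4"
  shows "n * norm (q' - q) / 2 \<le> norm (x - z)"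
proof -
  obtain y where y: "dist q' y < \<delta>" "x = n *\<^sub>R y" using x by auto
  have eq: "n *\<^sub>R (q' - q) = ((x - z) - n *\<^sub>R (y - q')) + (z - n *\<^sub>R q)"
    using y(2) by (simp add: algebra_simps)
  have "n * norm (q' - q) = norm (n *\<^sub>R (q' - q))" using n by simp
  also have "\<dots> \<le> norm (x - z) + norm (n *\<^sub>R (y - q')) + norm (z - n *\<^sub>R q)"
    unfolding eq using norm_triangle_ineq[of "(x - z) - n *\<^sub>R (y - q')" "z - n *\<^sub>R q"]
      norm_triangle_ineq4[of "x - z" "n *\<^sub>R (y - q')"] by linarith
  finally have "n * norm (q' - q) \<le> norm (x - z) + norm (n *\<^sub>R (y - q')) + norm (z - n *\<^sub>R q)" .
  moreover have "norm (n *\<^sub>R (y - q')) \<le> n * \<delta>"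
    using y(1) n by (simp add: dist_norm norm_minus_commute mult_left_mono)
  moreover have "n * \<delta> \<le> n * (norm (q' - q) / 4)" using \<delta> n by (intro mult_left_mono)
  ultimately show ?thesis using z by (simp add: algebra_simps)
qed

lemma ereal_le_uminus_if_forall_less:
  fixes x y :: ereal
  assumes "\<And>\<alpha>. ereal \<alpha> < y \<Longrightarrow> x \<le> ereal (-\<alpha>)"
  shows "x \<le> -y"
proof -
  have "y \<le> -x"
  proof (rule dense_le)
    fix w assume w: "w < y"
    show "w \<le> -x"
    proof (cases w)
      case (real \<alpha>)
      then show ?thesis
        using assms[of \<alpha>] w by (metis ereal_minus_le_minus ereal_uminus_uminus uminus_ereal.simps(1))
    qed (use w in auto)
  qed
  then show ?thesis by (metis ereal_minus_le_minus ereal_uminus_uminus)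
qed

section \<open>Markov processes with exponential moments\<close>

lemma nat_filt_space: "space N \<in> nat_filt N Z u"
proof -
  let ?M = "sigma (space N) (\<Union>s\<in>{0..u}. {Z s -` B \<inter> space N | B. B \<in> sets borel})"
  have "space ?M \<in> sets ?M" by (rule sets.top)
  then show ?thesis unfolding nat_filt_def by (simp only: space_measure_of_conv)
qed

lemma is_stopping_time_const:
  assumes "s \<ge> 0"
  shows "is_stopping_time N Z (\<lambda>_. ennreal s)"
    and "space N \<in> pre_tau N Z (\<lambda>_. ennreal s)"
proof -
  have key: "{\<omega>\<in>space N. ennreal s \<le> ennreal t} \<in> nat_filt_plus N Z t" for t
  proof (cases "ennreal s \<le> ennreal t")
    case True
    then show ?thesis by (auto simp: nat_filt_plus_def nat_filt_space)
  next
    case False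
    then show ?thesis by (simp add: nat_filt_plus_def nat_filt_def sets.empty_sets)
  qed
  then show "is_stopping_time N Z (\<lambda>_. ennreal s)" unfolding is_stopping_time_def by blast
  have "space N \<inter> {\<omega>\<in>space N. ennreal s \<le> ennreal t} \<in> nat_filt_plus N Z t" for t
    using key[of t] by (simp add: Int_absorb1)
  then show "space N \<in> pre_tau N Z (\<lambda>_. ennreal s)"
    unfolding pre_tau_def using sets.top[of N] by blast
qed

definition sup_exp_moment :: "'a::euclidean_space set \<Rightarrow> ('a \<Rightarrow> 'w measure) \<Rightarrow> (real \<Rightarrow> 'w \<Rightarrow> 'a) \<Rightarrow> 'a \<Rightarrow> ennreal" where
  "sup_exp_moment E P Z a = (SUP z\<in>E. SUP t\<in>{0..1}. \<integral>\<^sup>+ \<omega>. ennreal (exp (a \<bullet> (Z t \<omega> - z))) \<partial>P z)"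

lemma H2_iff_sup_exp_moment: "H2 E P Z \<longleftrightarrow> (\<forall>a. sup_exp_moment E P Z a < \<infinity>)"
  by (simp add: H2_def sup_exp_moment_def)

locale markov_process =
  fixes E :: "'a::euclidean_space set" and N :: "'w measure" and P :: "'a \<Rightarrow> 'w measure"
    and Z :: "real \<Rightarrow> 'w \<Rightarrow> 'a"
  assumes strong_markov: "strong_markov_cadlag E N P Z"
begin

lemma prob_space_P: "z \<in> E \<Longrightarrow> prob_space (P z)"
  using strong_markov[unfolded strong_markov_cadlag_def, THEN conjunct1] by blast

lemma sets_P: "z \<in> E \<Longrightarrow> sets (P z) = sets N"
  using strong_markov[unfolded strong_markov_cadlag_def, THEN conjunct1] by blast

lemma space_P: "z \<in> E \<Longrightarrow> space (P z) = space N"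
  using sets_P sets_eq_imp_space_eq by blast

lemma AE_start: "z \<in> E \<Longrightarrow> AE \<omega> in P z. Z 0 \<omega> = z"
  using strong_markov[unfolded strong_markov_cadlag_def, THEN conjunct2, THEN conjunct1] by blast

lemma measurable_Z:
  assumes "t \<ge> 0" "z \<in> E" shows "Z t \<in> borel_measurable (P z)"
  unfolding measurable_cong_sets[OF sets_P[OF assms(2)] refl]
  using strong_markov[unfolded strong_markov_cadlag_def, THEN conjunct2, THEN conjunct2, THEN conjunct1]
    assms(1) by blast

lemma Z_in_E: "t \<ge> 0 \<Longrightarrow> \<omega> \<in> space N \<Longrightarrow> Z t \<omega> \<in> E"
  using strong_markov[unfolded strong_markov_cadlag_def, THEN conjunct2, THEN conjunct2, THEN conjunct2,
      THEN conjunct1] by blast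

lemma measurable_transition:
  "s \<ge> 0 \<Longrightarrow> B \<in> sets borel \<Longrightarrow>
    (\<lambda>z. emeasure (P z) {\<omega>\<in>space N. Z s \<omega> \<in> B}) \<in> borel_measurable (restrict_space borel E)"
  using strong_markov[unfolded strong_markov_cadlag_def, THEN conjunct2, THEN conjunct2, THEN conjunct2,
      THEN conjunct2, THEN conjunct2, THEN conjunct2, THEN conjunct1] by blast

lemma markov_property:
  assumes y: "y \<in> E" and s: "s \<ge> 0" and u: "u \<ge> 0" and B: "B \<in> sets borel"
  shows "emeasure (P y) {\<omega>\<in>space N. Z (s+u) \<omega> \<in> B}
     = (\<integral>\<^sup>+\<omega>. emeasure (P (Z s \<omega>)) {\<omega>'\<in>space N. Z u \<omega>' \<in> B} \<partial>P y)"
proof -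
  have "emeasure (P y) {\<omega>\<in>space N. ennreal s < \<infinity> \<and> Z (enn2real (ennreal s) + u) \<omega> \<in> B}
        = (\<integral>\<^sup>+ \<omega>. indicator {\<omega>\<in>space N. ennreal s < \<infinity>} \<omega> *
              emeasure (P (Z (enn2real (ennreal s)) \<omega>)) {\<omega>'\<in>space N. Z u \<omega>' \<in> B} \<partial>P y)"
    using strong_markov[unfolded strong_markov_cadlag_def, THEN conjunct2, THEN conjunct2, THEN conjunct2,
      THEN conjunct2, THEN conjunct2, THEN conjunct2, THEN conjunct2] y is_stopping_time_const[OF s] u B
    by blast
  also have "\<dots> = (\<integral>\<^sup>+\<omega>. emeasure (P (Z s \<omega>)) {\<omega>'\<in>space N. Z u \<omega>' \<in> B} \<partial>P y)"
    using s by (intro nn_integral_cong) (simp add: space_P[OF y])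
  finally show ?thesis using s by simp
qed

lemma emeasure_distr_Z:
  assumes "x \<in> E" "u \<ge> 0" "A \<in> sets borel"
  shows "emeasure (distr (P x) borel (Z u)) A = emeasure (P x) {\<omega>\<in>space N. Z u \<omega> \<in> A}"
proof -
  have "emeasure (distr (P x) borel (Z u)) A = emeasure (P x) (Z u -` A \<inter> space (P x))"
    using assms measurable_Z[OF assms(2,1)] by (simp add: emeasure_distr)
  also have "Z u -` A \<inter> space (P x) = {\<omega>\<in>space N. Z u \<omega> \<in> A}"
    using space_P[OF assms(1)] by auto
  finally show ?thesis .
qed

lemma measurable_transition_kernel:
  assumes u: "u \<ge> 0"
  shows "(\<lambda>x. distr (P x) borel (Z u)) \<in> measurable (restrict_space borel E) (subprob_algebra borel)"
proof (rule measurable_subprob_algebra)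
  fix x assume "x \<in> space (restrict_space borel E)"
  then have x: "x \<in> E" by (simp add: space_restrict_space)
  show "subprob_space (distr (P x) borel (Z u))"
    using prob_space.prob_space_distr[OF prob_space_P[OF x] measurable_Z[OF u x]]
    by (simp add: prob_space_imp_subprob_space)
  show "sets (distr (P x) borel (Z u)) = sets borel" by simp
next
  fix A :: "'a set" assume A: "A \<in> sets borel"
  from measurable_transition[OF u A]
  show "(\<lambda>x. emeasure (distr (P x) borel (Z u)) A) \<in> borel_measurable (restrict_space borel E)"
    by (rule measurable_cong[THEN iffD1, rotated]) (simp add: emeasure_distr_Z u A space_restrict_space)
qed

lemma measurable_Z_restrict:
  "s \<ge> 0 \<Longrightarrow> y \<in> E \<Longrightarrow> Z s \<in> measurable (P y) (restrict_space borel E)"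
  by (rule measurable_restrict_space2) (auto simp: space_P Z_in_E measurable_Z)

lemma distr_Z_add:
  assumes y: "y \<in> E" and s: "s \<ge> 0" and u: "u \<ge> 0"
  shows "distr (P y) borel (Z (s+u))
    = distr (P y) (restrict_space borel E) (Z s) \<bind> (\<lambda>x. distr (P x) borel (Z u))"
proof (rule measure_eqI)
  let ?\<nu> = "distr (P y) (restrict_space borel E) (Z s)" and ?K = "\<lambda>x. distr (P x) borel (Z u)"
  have "space ?\<nu> \<noteq> {}" using y by (auto simp: space_restrict_space)
  moreover have K: "?K \<in> measurable ?\<nu> (subprob_algebra borel)"
    using measurable_transition_kernel[OF u] by (simp cong: measurable_cong_sets)
  ultimately show "sets (distr (P y) borel (Z (s + u))) = sets (?\<nu> \<bind> ?K)"
    by (simp add: sets_bind)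
  fix X assume "X \<in> sets (distr (P y) borel (Z (s + u)))"
  then have X: "X \<in> sets borel" by simp
  have "emeasure (?\<nu> \<bind> ?K) X = (\<integral>\<^sup>+x. emeasure (?K x) X \<partial>?\<nu>)"
    by (rule emeasure_bind[OF \<open>space ?\<nu> \<noteq> {}\<close> K X])
  also have "\<dots> = (\<integral>\<^sup>+\<omega>. emeasure (?K (Z s \<omega>)) X \<partial>P y)"
    by (rule nn_integral_distr[OF measurable_Z_restrict[OF s y]])
       (rule measurable_compose[OF K measurable_emeasure_subprob_algebra[OF X]])
  also have "\<dots> = (\<integral>\<^sup>+\<omega>. emeasure (P (Z s \<omega>)) {\<omega>'\<in>space N. Z u \<omega>' \<in> X} \<partial>P y)"
    by (rule nn_integral_cong) (simp add: emeasure_distr_Z u X Z_in_E[OF s] space_P[OF y])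
  also have "\<dots> = emeasure (P y) {\<omega>\<in>space N. Z (s+u) \<omega> \<in> X}"
    by (rule markov_property[OF y s u X, symmetric])
  also have "\<dots> = emeasure (distr (P y) borel (Z (s + u))) X"
    using s u X by (simp add: emeasure_distr_Z y)
  finally show "emeasure (distr (P y) borel (Z (s + u))) X = emeasure (?\<nu> \<bind> ?K) X" by simp
qed

lemma markov_property_nn_integral:
  assumes y: "y \<in> E" and s: "s \<ge> 0" and u: "u \<ge> 0" and f: "f \<in> borel_measurable borel"
  shows "(\<integral>\<^sup>+\<omega>. f (Z (s+u) \<omega>) \<partial>P y) = (\<integral>\<^sup>+\<omega>. (\<integral>\<^sup>+\<omega>'. f (Z u \<omega>') \<partial>P (Z s \<omega>)) \<partial>P y)"
proof -
  have K: "(\<lambda>x. distr (P x) borel (Z u))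
      \<in> measurable (distr (P y) (restrict_space borel E) (Z s)) (subprob_algebra borel)"
    using measurable_transition_kernel[OF u] by (simp cong: measurable_cong_sets)
  have "(\<integral>\<^sup>+\<omega>. f (Z (s+u) \<omega>) \<partial>P y) = (\<integral>\<^sup>+x. f x \<partial>distr (P y) borel (Z (s+u)))"
    using s u by (subst nn_integral_distr) (auto intro: measurable_Z[OF _ y] f)
  also have "\<dots> = (\<integral>\<^sup>+x. \<integral>\<^sup>+v. f v \<partial>distr (P x) borel (Z u) \<partial>distr (P y) (restrict_space borel E) (Z s))"
    unfolding distr_Z_add[OF y s u] by (rule nn_integral_bind[OF f K])
  also have "\<dots> = (\<integral>\<^sup>+\<omega>. \<integral>\<^sup>+v. f v \<partial>distr (P (Z s \<omega>)) borel (Z u) \<partial>P y)"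
    by (rule nn_integral_distr[OF measurable_Z_restrict[OF s y]])
       (rule measurable_compose[OF K nn_integral_measurable_subprob_algebra[OF f]])
  also have "\<dots> = (\<integral>\<^sup>+\<omega>. (\<integral>\<^sup>+\<omega>'. f (Z u \<omega>') \<partial>P (Z s \<omega>)) \<partial>P y)"
  proof (rule nn_integral_cong)
    fix \<omega> assume "\<omega> \<in> space (P y)"
    then have x: "Z s \<omega> \<in> E" using Z_in_E[OF s] space_P[OF y] by auto
    show "(\<integral>\<^sup>+v. f v \<partial>distr (P (Z s \<omega>)) borel (Z u)) = (\<integral>\<^sup>+\<omega>'. f (Z u \<omega>') \<partial>P (Z s \<omega>))"
      using f by (intro nn_integral_distr[OF measurable_Z[OF u x]]) simp
  qed
  finally show ?thesis .
qed

lemma exp_moment_le_sup_exp_moment: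
  assumes "y \<in> E" "t \<in> {0..1}"
  shows "(\<integral>\<^sup>+ \<omega>. ennreal (exp (a \<bullet> (Z t \<omega> - y))) \<partial>P y) \<le> sup_exp_moment E P Z a"
  unfolding sup_exp_moment_def using assms by (intro SUP_upper2[of y] SUP_upper) auto

lemma one_le_sup_exp_moment:
  assumes y: "y \<in> E" shows "1 \<le> sup_exp_moment E P Z a"
proof -
  have "(\<integral>\<^sup>+ \<omega>. ennreal (exp (a \<bullet> (Z 0 \<omega> - y))) \<partial>P y) = (\<integral>\<^sup>+ \<omega>. 1 \<partial>P y)"
    by (rule nn_integral_cong_AE) (use AE_start[OF y] in \<open>auto elim!: AE_mp\<close>)
  also have "\<dots> = 1" using prob_space.emeasure_space_1[OF prob_space_P[OF y]] by simp
  finally show ?thesis using exp_moment_le_sup_exp_moment[OF y, of 0 a] by simp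
qed

lemma exp_moment_le_power:
  "y \<in> E \<Longrightarrow> u \<in> {0..real (Suc k)} \<Longrightarrow>
     (\<integral>\<^sup>+ \<omega>. ennreal (exp (a \<bullet> (Z u \<omega> - y))) \<partial>P y) \<le> sup_exp_moment E P Z a ^ Suc k"
proof (induction k arbitrary: y u)
  case 0
  then show ?case using exp_moment_le_sup_exp_moment by simp
next
  case (Suc k)
  note y = Suc.prems(1)
  let ?\<phi> = "sup_exp_moment E P Z a"
  have meas: "(\<lambda>\<omega>. ennreal (exp (a \<bullet> (Z t \<omega> - x)))) \<in> borel_measurable (P z)"
    if "t \<ge> 0" "z \<in> E" for t x z
    using measurable_Z[OF that] by measurable
  show ?case
  proof (cases "u \<le> 1")
    case True
    then have "(\<integral>\<^sup>+ \<omega>. ennreal (exp (a \<bullet> (Z u \<omega> - y))) \<partial>P y) \<le> ?\<phi>"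
      using exp_moment_le_sup_exp_moment[OF y] Suc.prems(2) by simp
    also have "\<dots> \<le> ?\<phi> ^ Suc (Suc k)"
      using power_increasing[of 1 "Suc (Suc k)" ?\<phi>] one_le_sup_exp_moment[OF y] by simp
    finally show ?thesis .
  next
    case False
    define u' where "u' = u - 1"
    have u': "u' \<in> {0..real (Suc k)}" "u = 1 + u'" using False Suc.prems(2) by (auto simp: u'_def)
    have "(\<integral>\<^sup>+ \<omega>. ennreal (exp (a \<bullet> (Z u \<omega> - y))) \<partial>P y)
        = (\<integral>\<^sup>+\<omega>. (\<integral>\<^sup>+\<omega>'. ennreal (exp (a \<bullet> (Z u' \<omega>' - y))) \<partial>P (Z 1 \<omega>)) \<partial>P y)"
      unfolding u'(2) using u'(1) by (intro markov_property_nn_integral[OF y]) auto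
    also have "\<dots> \<le> (\<integral>\<^sup>+\<omega>. ennreal (exp (a \<bullet> (Z 1 \<omega> - y))) * ?\<phi> ^ Suc k \<partial>P y)"
    proof (rule nn_integral_mono)
      fix \<omega> assume "\<omega> \<in> space (P y)"
      then have x: "Z 1 \<omega> \<in> E" using Z_in_E[of 1 \<omega>] space_P[OF y] by auto
      define x where "x = Z 1 \<omega>"
      have "(\<integral>\<^sup>+\<omega>'. ennreal (exp (a \<bullet> (Z u' \<omega>' - y))) \<partial>P x)
          = (\<integral>\<^sup>+\<omega>'. ennreal (exp (a \<bullet> (x - y))) * ennreal (exp (a \<bullet> (Z u' \<omega>' - x))) \<partial>P x)"
        by (rule nn_integral_cong) (simp add: ennreal_mult[symmetric] exp_add[symmetric] inner_diff_right)
      also have "\<dots> = ennreal (exp (a \<bullet> (x - y))) * (\<integral>\<^sup>+\<omega>'. ennreal (exp (a \<bullet> (Z u' \<omega>' - x))) \<partial>P x)"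
        using u' x by (intro nn_integral_cmult meas) (auto simp: x_def)
      also have "\<dots> \<le> ennreal (exp (a \<bullet> (x - y))) * ?\<phi> ^ Suc k"
        using x u'(1) by (intro mult_left_mono Suc.IH) (auto simp: x_def)
      finally show "(\<integral>\<^sup>+\<omega>'. ennreal (exp (a \<bullet> (Z u' \<omega>' - y))) \<partial>P (Z 1 \<omega>))
          \<le> ennreal (exp (a \<bullet> (Z 1 \<omega> - y))) * ?\<phi> ^ Suc k"
        unfolding x_def .
    qed
    also have "\<dots> = (\<integral>\<^sup>+\<omega>. ennreal (exp (a \<bullet> (Z 1 \<omega> - y))) \<partial>P y) * ?\<phi> ^ Suc k"
      using y by (intro nn_integral_multc meas) auto
    also have "\<dots> \<le> ?\<phi> * ?\<phi> ^ Suc k"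
      by (intro mult_right_mono exp_moment_le_sup_exp_moment[OF y]) auto
    finally show ?thesis by simp
  qed
qed

lemma directional_tail_le:
  assumes y: "y \<in> E" and u: "u \<in> {0..real (Suc k)}" and \<theta>: "\<theta> \<ge> 0" and "\<Phi> \<ge> 0"
    and \<Phi>: "sup_exp_moment E P Z (\<theta> *\<^sub>R v) \<le> ennreal \<Phi>"
  shows "emeasure (P y) {\<omega>\<in>space N. c \<le> (Z u \<omega> - y) \<bullet> v} \<le> ennreal (exp (-\<theta>*c) * \<Phi> ^ Suc k)"
proof -
  have "Z u \<in> borel_measurable (P y)" using u by (intro measurable_Z[OF _ y]) auto
  then have meas: "(\<lambda>\<omega>. (Z u \<omega> - y) \<bullet> v) \<in> borel_measurable (P y)" by measurable
  have "emeasure (P y) {\<omega>\<in>space N. c \<le> (Z u \<omega> - y) \<bullet> v}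
      \<le> ennreal (exp (-\<theta>*c)) * (\<integral>\<^sup>+\<omega>. ennreal (exp (\<theta> * ((Z u \<omega> - y) \<bullet> v))) \<partial>P y)"
    using emeasure_ge_le_exp_moment[OF meas \<theta>, of c] by (simp add: space_P[OF y])
  also have "(\<integral>\<^sup>+\<omega>. ennreal (exp (\<theta> * ((Z u \<omega> - y) \<bullet> v))) \<partial>P y)
      = (\<integral>\<^sup>+\<omega>. ennreal (exp ((\<theta> *\<^sub>R v) \<bullet> (Z u \<omega> - y))) \<partial>P y)"
    by (simp add: inner_commute)
  also have "\<dots> \<le> ennreal \<Phi> ^ Suc k"
    using exp_moment_le_power[OF y u] \<Phi> by (meson order_trans power_mono zero_le)
  finally show ?thesis
    using \<open>\<Phi> \<ge> 0\<close> by (simp add: ennreal_mult ennreal_power mult_left_mono)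
qed

lemma displacement_tail_le:
  fixes \<Phi> :: real
  assumes y: "y \<in> E" and u: "u \<in> {0..real (Suc k)}" and \<theta>: "\<theta> \<ge> 0" and \<Phi>: "\<Phi> \<ge> 0"
    and mgf: "\<And>i. i \<in> Basis \<Longrightarrow>
      sup_exp_moment E P Z (\<theta> *\<^sub>R i) \<le> ennreal \<Phi> \<and> sup_exp_moment E P Z (-(\<theta> *\<^sub>R i)) \<le> ennreal \<Phi>"
  shows "emeasure (P y) {\<omega>\<in>space N. r \<le> norm (Z u \<omega> - y)}
      \<le> ennreal (2 * DIM('a) * \<Phi> ^ Suc k * exp (-\<theta>*(r/DIM('a))))"
proof -
  let ?c = "r / DIM('a)" and ?b = "exp (-\<theta>*(r/DIM('a))) * \<Phi> ^ Suc k"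
  define A where "A v = {\<omega>\<in>space N. ?c \<le> (Z u \<omega> - y) \<bullet> v}" for v
  have "Z u \<in> borel_measurable (P y)" using u by (intro measurable_Z[OF _ y]) auto
  then have A: "A v \<in> sets (P y)" for v
    unfolding A_def space_P[OF y, symmetric] by measurable
  have bound: "emeasure (P y) (A i) \<le> ennreal ?b" "emeasure (P y) (A (-i)) \<le> ennreal ?b"
    if "i \<in> Basis" for i
    using directional_tail_le[OF y u \<theta> \<Phi>, of i ?c] directional_tail_le[OF y u \<theta> \<Phi>, of "-i" ?c] mgf[OF that]
    unfolding A_def by (simp_all add: mult_ac)
  have "{\<omega>\<in>space N. r \<le> norm (Z u \<omega> - y)} \<subseteq> (\<Union>i\<in>Basis. A i \<union> A (-i))"
  proof
    fix \<omega> assume "\<omega> \<in> {\<omega>\<in>space N. r \<le> norm (Z u \<omega> - y)}"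
    moreover from this obtain i where "i \<in> Basis" "?c \<le> \<bar>(Z u \<omega> - y) \<bullet> i\<bar>"
      using exists_Basis_abs_inner_ge by blast
    ultimately show "\<omega> \<in> (\<Union>i\<in>Basis. A i \<union> A (-i))"
      unfolding A_def by (cases "0 \<le> (Z u \<omega> - y) \<bullet> i") auto
  qed
  then have "emeasure (P y) {\<omega>\<in>space N. r \<le> norm (Z u \<omega> - y)} \<le> emeasure (P y) (\<Union>i\<in>Basis. A i \<union> A (-i))"
    using A by (intro emeasure_mono) auto
  also have "\<dots> \<le> (\<Sum>i\<in>Basis. emeasure (P y) (A i \<union> A (-i)))"
    using A by (intro emeasure_subadditive_finite) auto
  also have "\<dots> \<le> (\<Sum>i\<in>(Basis::'a set). ennreal ?b + ennreal ?b)"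
    using A bound by (intro sum_mono order_trans[OF emeasure_subadditive add_mono]) auto
  also have "\<dots> = ennreal (2 * DIM('a) * \<Phi> ^ Suc k * exp (-\<theta>*(r/DIM('a))))"
    using \<Phi> by (simp add: ennreal_of_nat_eq_real_of_nat ennreal_mult[symmetric] ennreal_plus[symmetric] mult_ac
        del: ennreal_plus)
  finally show ?thesis .
qed

lemma small_time_bound:
  assumes h2: "H2 E P Z" and D: "norm (q' - q) > 0" and A: "A \<ge> 0"
  obtains s C where "s > 0" "C > 0" "\<And>n \<delta> t z. n > 0 \<Longrightarrow> \<delta> \<le> norm (q' - q) / 4 \<Longrightarrow>
      0 \<le> t \<Longrightarrow> t \<le> s * n \<Longrightarrow> z \<in> E \<Longrightarrow> norm (z - n *\<^sub>R q) < \<delta> * n \<Longrightarrow>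
        emeasure (P z) {\<omega>\<in>space N. Z t \<omega> \<in> (\<lambda>x. n *\<^sub>R x) ` ball q' \<delta>} \<le> ennreal (C * exp (-(A*n)))"
proof -
  define d where "d = real DIM('a)"
  have d: "d > 0" by (simp add: d_def)
  (* \<theta> makes the Chernoff exponent for a displacement n |q' - q| / 2 equal to (A + 1) n, and s keeps
     the growth \<Phi>^t of the exponential moments below \<Phi>^2 e^n. *)
  define \<theta> where "\<theta> = 2 * d * (A + 1) / norm (q' - q)"
  have \<theta>: "\<theta> \<ge> 0" using d A D by (simp add: \<theta>_def)
  define \<Phi> where "\<Phi> = 1 + (\<Sum>i\<in>(Basis::'a set).
      enn2real (sup_exp_moment E P Z (\<theta> *\<^sub>R i)) + enn2real (sup_exp_moment E P Z (-(\<theta> *\<^sub>R i))))"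
  have \<Phi>: "\<Phi> \<ge> 1" unfolding \<Phi>_def by (simp add: sum_nonneg)
  have mgf: "sup_exp_moment E P Z (\<theta> *\<^sub>R i) \<le> ennreal \<Phi> \<and> sup_exp_moment E P Z (-(\<theta> *\<^sub>R i)) \<le> ennreal \<Phi>"
    if i: "i \<in> Basis" for i
  proof -
    have fin: "sup_exp_moment E P Z a = ennreal (enn2real (sup_exp_moment E P Z a))" for a
      using h2 by (simp add: H2_iff_sup_exp_moment ennreal_enn2real_if less_top[symmetric])
    have "enn2real (sup_exp_moment E P Z (\<theta> *\<^sub>R i)) + enn2real (sup_exp_moment E P Z (-(\<theta> *\<^sub>R i))) \<le> \<Phi> - 1"
      unfolding \<Phi>_def using i
      by (simp add: member_le_sum[of i Basis "\<lambda>i. enn2real (sup_exp_moment E P Z (\<theta> *\<^sub>R i))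
          + enn2real (sup_exp_moment E P Z (-(\<theta> *\<^sub>R i)))"])
    then have "enn2real (sup_exp_moment E P Z (\<theta> *\<^sub>R i)) \<le> \<Phi>"
        "enn2real (sup_exp_moment E P Z (-(\<theta> *\<^sub>R i))) \<le> \<Phi>"
      using enn2real_nonneg[of "sup_exp_moment E P Z (\<theta> *\<^sub>R i)"]
        enn2real_nonneg[of "sup_exp_moment E P Z (-(\<theta> *\<^sub>R i))"] by linarith+
    then show ?thesis by (subst (1 2) fin) (auto intro!: ennreal_leI)
  qed
  define s where "s = 1 / (1 + ln \<Phi>)"
  have "ln \<Phi> \<ge> 0" using \<Phi> by simp
  then have s: "s > 0" "s * ln \<Phi> \<le> 1" by (auto simp: s_def field_simps)
  define C where "C = 2 * d * \<Phi>\<^sup>2"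
  have C: "C > 0" using d \<Phi> by (simp add: C_def)
  show ?thesis
  proof (rule that[OF s(1) C])
    fix n \<delta> t z
    assume n: "0 < n" and \<delta>: "\<delta> \<le> norm (q' - q) / 4" and t: "0 \<le> t" "t \<le> s * n" and z: "z \<in> E"
      and nz: "norm (z - n *\<^sub>R q) < \<delta> * n"
    define k where "k = nat \<lceil>t\<rceil>"
    have u: "t \<in> {0..real (Suc k)}" using t by (auto simp: k_def) linarith
    have "Z t \<in> borel_measurable (P z)" using t by (intro measurable_Z z)
    then have meas: "{\<omega>\<in>space N. n * norm (q' - q) / 2 \<le> norm (Z t \<omega> - z)} \<in> sets (P z)"
      unfolding space_P[OF z, symmetric] by measurable
    have "emeasure (P z) {\<omega>\<in>space N. Z t \<omega> \<in> (\<lambda>x. n *\<^sub>R x) ` ball q' \<delta>}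
        \<le> emeasure (P z) {\<omega>\<in>space N. n * norm (q' - q) / 2 \<le> norm (Z t \<omega> - z)}"
      using norm_diff_ge_of_mem_scaled_ball[OF _ nz less_imp_le[OF n] \<delta>] by (intro emeasure_mono meas) auto
    also have "\<dots> \<le> ennreal (2 * d * \<Phi> ^ Suc k * exp (-\<theta> * (n * norm (q' - q) / 2 / d)))"
      using displacement_tail_le[OF z u \<theta> _ mgf, of "n * norm (q' - q) / 2"] \<Phi> unfolding d_def by simp
    also have "\<dots> \<le> ennreal (C * exp (-(A*n)))"
    proof (rule ennreal_leI)
      have "-\<theta> * (n * norm (q' - q) / 2 / d) = -((A+1)*n)" using d D by (simp add: \<theta>_def field_simps)
      moreover have "\<Phi> ^ Suc k \<le> \<Phi>\<^sup>2 * exp n"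
        unfolding k_def by (rule power_Suc_ceiling_le[OF \<Phi> t s(2) s(1) n])
      ultimately have "2 * d * \<Phi> ^ Suc k * exp (-\<theta> * (n * norm (q' - q) / 2 / d))
          \<le> 2 * d * (\<Phi>\<^sup>2 * exp n) * exp (-((A+1)*n))"
        using d by (simp add: mult_right_mono mult_left_mono)
      also have "\<dots> = C * exp (-(A*n))" by (simp add: C_def exp_add[symmetric] algebra_simps)
      finally show "2 * d * \<Phi> ^ Suc k * exp (-\<theta> * (n * norm (q' - q) / 2 / d)) \<le> C * exp (-(A*n))" .
    qed
    finally show "emeasure (P z) {\<omega>\<in>space N. Z t \<omega> \<in> (\<lambda>x. n *\<^sub>R x) ` ball q' \<delta>} \<le> ennreal (C * exp (-(A*n)))" .
  qed
qed

end

section \<open>Consequences of the large deviation principle\<close>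

lemma H1_lsc:
  assumes "H1 E N P Z I" "T > 0" shows "lsc (\<lambda>p. I T (fst p) (snd p))"
  using assms(1)[unfolded H1_def, rule_format, OF assms(2)] by (rule conjunct1)

lemma H1_upper_eventually:
  assumes h: "H1 E N P Z I" and T: "T > 0" and V: "compact V"
    and c: "\<forall>q''\<in>V. ennreal c \<le> I T q q''" and c': "c' < c"
  shows "\<forall>\<^sub>F \<delta> in at_right 0. \<forall>\<^sub>F \<epsilon> in at_right 0. \<forall>z\<in>E. norm (\<epsilon> *\<^sub>R z - q) < \<delta> \<longrightarrow>
           emeasure (P z) {\<omega>\<in>space N. \<epsilon> *\<^sub>R Z (T/\<epsilon>) \<omega> \<in> V} \<le> ennreal (exp (-c'/\<epsilon>))"
proof -
  define F where "F \<delta> \<epsilon> = ereal \<epsilon> * elog (SUP z\<in>{z\<in>E. norm (\<epsilon> *\<^sub>R z - q) < \<delta>}.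
                   emeasure (P z) {\<omega>\<in>space N. \<epsilon> *\<^sub>R Z (T / \<epsilon>) \<omega> \<in> V})" for \<delta> \<epsilon>
  have "ennreal c \<le> (INF q''\<in>V. I T q q'')" using c by (intro INF_greatest) auto
  then have "ereal c \<le> enn2ereal (INF q''\<in>V. I T q q'')"
    by (cases "c \<ge> 0") (auto simp: less_eq_ennreal.rep_eq intro: order_trans[OF _ enn2ereal_nonneg])
  with c' have "ereal c' < enn2ereal (INF q''\<in>V. I T q q'')"
    using less_le_trans[of "ereal c'" "ereal c"] by simp
  then have "- enn2ereal (INF q''\<in>V. I T q q'') < - ereal c'" by (simp only: ereal_minus_less_minus)
  moreover have "Limsup (at_right 0) (\<lambda>\<delta>. Limsup (at_right 0) (F \<delta>)) \<le> - enn2ereal (INF q''\<in>V. I T q q'')"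
    unfolding F_def by (rule h[unfolded H1_def, rule_format, OF T, THEN conjunct2, THEN conjunct2, rule_format, OF V])
  ultimately have "Limsup (at_right 0) (\<lambda>\<delta>. Limsup (at_right 0) (F \<delta>)) < - ereal c'"
    by (rule le_less_trans[rotated])
  then have "\<forall>\<^sub>F \<delta> in at_right 0. Limsup (at_right 0) (F \<delta>) < - ereal c'"
    by (rule Limsup_lessD)
  then show ?thesis
  proof (rule eventually_mono)
    fix \<delta> assume "Limsup (at_right 0) (F \<delta>) < - ereal c'"
    from Limsup_lessD[OF this] eventually_at_right_less[of "0::real"]
    show "\<forall>\<^sub>F \<epsilon> in at_right 0. \<forall>z\<in>E. norm (\<epsilon> *\<^sub>R z - q) < \<delta> \<longrightarrow>
        emeasure (P z) {\<omega>\<in>space N. \<epsilon> *\<^sub>R Z (T/\<epsilon>) \<omega> \<in> V} \<le> ennreal (exp (-c'/\<epsilon>))"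
    proof eventually_elim
      case (elim \<epsilon>)
      show ?case
      proof (intro ballI impI)
        fix z assume "z \<in> E" "norm (\<epsilon> *\<^sub>R z - q) < \<delta>"
        then have "ereal \<epsilon> * elog (emeasure (P z) {\<omega>\<in>space N. \<epsilon> *\<^sub>R Z (T/\<epsilon>) \<omega> \<in> V}) \<le> F \<delta> \<epsilon>"
          unfolding F_def using elim(2) by (intro ereal_mult_left_mono elog_mono SUP_upper) auto
        also have "\<dots> \<le> ereal (- c')" using elim(1) by simp
        finally show "emeasure (P z) {\<omega>\<in>space N. \<epsilon> *\<^sub>R Z (T/\<epsilon>) \<omega> \<in> V} \<le> ennreal (exp (-c'/\<epsilon>))"
          using ereal_mult_elog_le_iff[OF elim(2)] by simp
      qed
    qed
  qed
qed

lemma H1_lower_eventually: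
  assumes h: "H1 E N P Z I" and T: "T > 0" and U: "open U"
    and j: "(INF q''\<in>U. I T q q'') < ennreal j"
  shows "\<forall>\<^sub>F \<delta> in at_right 0. \<forall>\<^sub>F \<epsilon> in at_right 0. \<forall>z\<in>E. norm (\<epsilon> *\<^sub>R z - q) < \<delta> \<longrightarrow>
           ennreal (exp (-j/\<epsilon>)) < emeasure (P z) {\<omega>\<in>space N. \<epsilon> *\<^sub>R Z (T/\<epsilon>) \<omega> \<in> U}"
proof -
  define G where "G \<delta> \<epsilon> = ereal \<epsilon> * elog (INF z\<in>{z\<in>E. norm (\<epsilon> *\<^sub>R z - q) < \<delta>}.
                   emeasure (P z) {\<omega>\<in>space N. \<epsilon> *\<^sub>R Z (T / \<epsilon>) \<omega> \<in> U})" for \<delta> \<epsilon>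
  have "j > 0" using j by (cases "j > 0") (auto simp: ennreal_neg)
  then have "enn2ereal (INF q''\<in>U. I T q q'') < ereal j"
    using j by (simp add: less_ennreal.rep_eq)
  then have "- ereal j < - enn2ereal (INF q''\<in>U. I T q q'')" by (simp only: ereal_minus_less_minus)
  moreover have "- enn2ereal (INF q''\<in>U. I T q q'') \<le> Liminf (at_right 0) (\<lambda>\<delta>. Liminf (at_right 0) (G \<delta>))"
    unfolding G_def by (rule h[unfolded H1_def, rule_format, OF T, THEN conjunct2, THEN conjunct1, rule_format, OF U])
  ultimately have "- ereal j < Liminf (at_right 0) (\<lambda>\<delta>. Liminf (at_right 0) (G \<delta>))"
    by (rule less_le_trans)
  then have "\<forall>\<^sub>F \<delta> in at_right 0. - ereal j < Liminf (at_right 0) (G \<delta>)"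
    by (rule less_LiminfD)
  then show ?thesis
  proof (rule eventually_mono)
    fix \<delta> assume "- ereal j < Liminf (at_right 0) (G \<delta>)"
    from less_LiminfD[OF this] eventually_at_right_less[of "0::real"]
    show "\<forall>\<^sub>F \<epsilon> in at_right 0. \<forall>z\<in>E. norm (\<epsilon> *\<^sub>R z - q) < \<delta> \<longrightarrow>
        ennreal (exp (-j/\<epsilon>)) < emeasure (P z) {\<omega>\<in>space N. \<epsilon> *\<^sub>R Z (T/\<epsilon>) \<omega> \<in> U}"
    proof eventually_elim
      case (elim \<epsilon>)
      show ?case
      proof (intro ballI impI)
        fix z assume "z \<in> E" "norm (\<epsilon> *\<^sub>R z - q) < \<delta>"
        then have "G \<delta> \<epsilon> \<le> ereal \<epsilon> * elog (emeasure (P z) {\<omega>\<in>space N. \<epsilon> *\<^sub>R Z (T/\<epsilon>) \<omega> \<in> U})"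
          unfolding G_def using elim(2) by (intro ereal_mult_left_mono elog_mono INF_lower) auto
        with elim(1) have "\<not> ereal \<epsilon> * elog (emeasure (P z) {\<omega>\<in>space N. \<epsilon> *\<^sub>R Z (T/\<epsilon>) \<omega> \<in> U}) \<le> ereal (- j)"
          by simp
        then show "ennreal (exp (-j/\<epsilon>)) < emeasure (P z) {\<omega>\<in>space N. \<epsilon> *\<^sub>R Z (T/\<epsilon>) \<omega> \<in> U}"
          using ereal_mult_elog_le_iff[OF elim(2)] by (simp add: not_le)
      qed
    qed
  qed
qed

lemma escape_bound:
  assumes h: "H1 E N P Z I" and pos: "\<exists>T>0. I T 0 0 > 0"
  obtains \<kappa> \<rho> \<beta> t0 where "\<kappa> > 0" "\<rho> > 0" "\<beta> > 0" "\<And>t z. t > t0 \<Longrightarrow> z \<in> E \<Longrightarrow> norm z < \<kappa> * t \<Longrightarrow>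
           emeasure (P z) {\<omega>\<in>space N. norm (Z t \<omega>) \<le> \<rho> * t} \<le> ennreal (exp (-(\<beta> * t)))"
proof -
  obtain T where T: "T > 0" "0 < I T 0 0" using pos by blast
  obtain c where c: "0 < ennreal c" "ennreal c < I T 0 0" using ennreal_dense_real[OF T(2)] by blast
  then have "c > 0" by (simp add: ennreal_less_iff)
  obtain d where d: "d > 0" "\<And>p'. dist p' 0 < d \<Longrightarrow> ennreal c < I T 0 p'"
    using lsc_gt_on_ball[OF H1_lsc[OF h T(1)] c(2)] by blast
  define V where "V = cball (0::'a) (d/2)"
  have "\<forall>q''\<in>V. ennreal c \<le> I T 0 q''" using d unfolding V_def by (auto intro!: less_imp_le)
  from H1_upper_eventually[OF h T(1) _ this, of "c/2"]
  obtain \<delta> where \<delta>: "\<delta> > 0" and "\<forall>\<^sub>F \<epsilon> in at_right 0. \<forall>z\<in>E. norm (\<epsilon> *\<^sub>R z - 0) < \<delta> \<longrightarrow>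
      emeasure (P z) {\<omega>\<in>space N. \<epsilon> *\<^sub>R Z (T/\<epsilon>) \<omega> \<in> V} \<le> ennreal (exp (-(c/2)/\<epsilon>))"
    using \<open>c > 0\<close> unfolding V_def by (auto elim: eventually_at_right_0_obtain)
  then obtain e where e: "e > 0" "\<And>\<epsilon> z. 0 < \<epsilon> \<Longrightarrow> \<epsilon> < e \<Longrightarrow> z \<in> E \<Longrightarrow> norm (\<epsilon> *\<^sub>R z) < \<delta> \<Longrightarrow>
      emeasure (P z) {\<omega>\<in>space N. \<epsilon> *\<^sub>R Z (T/\<epsilon>) \<omega> \<in> V} \<le> ennreal (exp (-(c/2)/\<epsilon>))"
    unfolding eventually_at_right_field by auto
  show ?thesis
  proof (rule that[of "\<delta>/T" "d/(2*T)" "c/(2*T)" "T/e"])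
    show "\<delta>/T > 0" "d/(2*T) > 0" "c/(2*T) > 0" using \<delta> d(1) \<open>c > 0\<close> T(1) by auto
    fix t z assume t: "T/e < t" and z: "z \<in> E" and nz: "norm z < \<delta> / T * t"
    have "t > 0" using t T(1) e(1) by (smt (verit) divide_pos_pos)
    define \<epsilon> where "\<epsilon> = T / t"
    have \<epsilon>: "\<epsilon> > 0" "\<epsilon> < e" "T / \<epsilon> = t" using \<open>t > 0\<close> T(1) e(1) t by (auto simp: \<epsilon>_def field_simps)
    have "norm (\<epsilon> *\<^sub>R z) = \<epsilon> * norm z" using \<epsilon> by simp
    also have "\<dots> < \<epsilon> * (\<delta> / T * t)" using mult_strict_left_mono[OF nz \<epsilon>(1)] by simp
    also have "\<dots> = \<delta>" using \<open>t > 0\<close> T(1) by (simp add: \<epsilon>_def)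
    finally have "emeasure (P z) {\<omega>\<in>space N. \<epsilon> *\<^sub>R Z t \<omega> \<in> V} \<le> ennreal (exp (-(c/2)/\<epsilon>))"
      using e(2)[OF \<epsilon>(1,2) z] \<epsilon>(3) by simp
    moreover have "norm (Z t \<omega>) \<le> d / (2 * T) * t \<longleftrightarrow> \<epsilon> *\<^sub>R Z t \<omega> \<in> V" for \<omega>
      using \<open>t > 0\<close> T(1) by (simp add: V_def \<epsilon>_def field_simps)
    moreover have "-(c/2)/\<epsilon> = -(c / (2 * T) * t)" using \<open>t > 0\<close> T(1) by (simp add: \<epsilon>_def field_simps)
    ultimately show "emeasure (P z) {\<omega>\<in>space N. norm (Z t \<omega>) \<le> d / (2 * T) * t} \<le> ennreal (exp (-(c / (2 * T) * t)))"
      by simp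
  qed
qed

context markov_process
begin

lemma nested_events_rate_less:
  assumes q: "q \<in> scaling_limits E" and l: "l > 0" and T: "T = 1/l" and V: "V \<in> sets borel"
    and UV: "\<And>\<epsilon> x. (l * \<epsilon>) *\<^sub>R x \<in> U \<Longrightarrow> \<epsilon> *\<^sub>R x \<in> V"
    and upper: "\<forall>\<^sub>F \<delta> in at_right 0. \<forall>\<^sub>F \<epsilon> in at_right 0. \<forall>z\<in>E. norm (\<epsilon> *\<^sub>R z - q) < \<delta> \<longrightarrow>
      emeasure (P z) {\<omega>\<in>space N. \<epsilon> *\<^sub>R Z (T/\<epsilon>) \<omega> \<in> V} \<le> ennreal (exp (-c/\<epsilon>))"
    and lower: "\<forall>\<^sub>F \<delta> in at_right 0. \<forall>\<^sub>F \<epsilon> in at_right 0. \<forall>z\<in>E. norm (\<epsilon> *\<^sub>R z - l *\<^sub>R q) < \<delta> \<longrightarrow>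
      ennreal (exp (-j/\<epsilon>)) < emeasure (P z) {\<omega>\<in>space N. \<epsilon> *\<^sub>R Z (1/\<epsilon>) \<omega> \<in> U}"
  shows "l * c < j"
proof -
  obtain \<delta> where "\<delta> > 0"
    and upper\<delta>: "\<forall>\<^sub>F \<epsilon> in at_right 0. \<forall>z\<in>E. norm (\<epsilon> *\<^sub>R z - q) < \<delta> \<longrightarrow>
      emeasure (P z) {\<omega>\<in>space N. \<epsilon> *\<^sub>R Z (T/\<epsilon>) \<omega> \<in> V} \<le> ennreal (exp (-c/\<epsilon>))"
    and lower\<delta>: "\<forall>\<^sub>F \<epsilon> in at_right 0. \<forall>z\<in>E. norm (\<epsilon> *\<^sub>R z - l *\<^sub>R q) < l * \<delta> \<longrightarrow>
      ennreal (exp (-j/\<epsilon>)) < emeasure (P z) {\<omega>\<in>space N. \<epsilon> *\<^sub>R Z (1/\<epsilon>) \<omega> \<in> U}"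
    using eventually_at_right_0_obtain[OF eventually_conj[OF upper eventually_at_right_0_scale[OF l lower]]]
    by blast
  obtain zz where zz: "\<forall>\<epsilon>>0. zz \<epsilon> \<in> E" "((\<lambda>\<epsilon>. \<epsilon> *\<^sub>R zz \<epsilon>) \<longlongrightarrow> q) (at_right 0)"
    using q unfolding scaling_limits_def by blast
  have "\<forall>\<^sub>F \<epsilon> in at_right 0. dist (\<epsilon> *\<^sub>R zz \<epsilon>) q < \<delta>"
    using zz(2) \<open>\<delta> > 0\<close> unfolding tendsto_iff by blast
  with upper\<delta> eventually_at_right_0_scale[OF l lower\<delta>]
  have "\<forall>\<^sub>F \<epsilon> in at_right 0. (\<forall>z\<in>E. norm (\<epsilon> *\<^sub>R z - q) < \<delta> \<longrightarrow>
      emeasure (P z) {\<omega>\<in>space N. \<epsilon> *\<^sub>R Z (T/\<epsilon>) \<omega> \<in> V} \<le> ennreal (exp (-c/\<epsilon>))) \<and>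
    (\<forall>z\<in>E. norm ((l * \<epsilon>) *\<^sub>R z - l *\<^sub>R q) < l * \<delta> \<longrightarrow>
      ennreal (exp (-j/(l * \<epsilon>))) < emeasure (P z) {\<omega>\<in>space N. (l * \<epsilon>) *\<^sub>R Z (1/(l * \<epsilon>)) \<omega> \<in> U}) \<and>
    dist (\<epsilon> *\<^sub>R zz \<epsilon>) q < \<delta>"
    by eventually_elim blast
  then obtain \<epsilon> where \<epsilon>: "\<epsilon> > 0" and upper\<epsilon>: "\<forall>z\<in>E. norm (\<epsilon> *\<^sub>R z - q) < \<delta> \<longrightarrow>
      emeasure (P z) {\<omega>\<in>space N. \<epsilon> *\<^sub>R Z (T/\<epsilon>) \<omega> \<in> V} \<le> ennreal (exp (-c/\<epsilon>))"
    and lower\<epsilon>: "\<forall>z\<in>E. norm ((l * \<epsilon>) *\<^sub>R z - l *\<^sub>R q) < l * \<delta> \<longrightarrow>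
      ennreal (exp (-j/(l * \<epsilon>))) < emeasure (P z) {\<omega>\<in>space N. (l * \<epsilon>) *\<^sub>R Z (1/(l * \<epsilon>)) \<omega> \<in> U}"
    and "dist (\<epsilon> *\<^sub>R zz \<epsilon>) q < \<delta>"
    by (rule eventually_at_right_0_obtain) blast
  then have z: "zz \<epsilon> \<in> E" "norm (\<epsilon> *\<^sub>R zz \<epsilon> - q) < \<delta>" using zz(1) by (auto simp: dist_norm)
  note up = upper\<epsilon>[rule_format, OF z]
  note low = lower\<epsilon>[rule_format, OF z(1)]
  have "(l * \<epsilon>) *\<^sub>R zz \<epsilon> - l *\<^sub>R q = l *\<^sub>R (\<epsilon> *\<^sub>R zz \<epsilon> - q)" by (simp add: algebra_simps)
  then have "ennreal (exp (-j/(l * \<epsilon>)))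
      < emeasure (P (zz \<epsilon>)) {\<omega>\<in>space N. (l * \<epsilon>) *\<^sub>R Z (1/(l * \<epsilon>)) \<omega> \<in> U}"
    using low z(2) l by simp
  also have "\<dots> \<le> emeasure (P (zz \<epsilon>)) {\<omega>\<in>space N. \<epsilon> *\<^sub>R Z (T/\<epsilon>) \<omega> \<in> V}"
  proof (rule emeasure_mono)
    show "{\<omega>\<in>space N. (l * \<epsilon>) *\<^sub>R Z (1/(l * \<epsilon>)) \<omega> \<in> U} \<subseteq> {\<omega>\<in>space N. \<epsilon> *\<^sub>R Z (T/\<epsilon>) \<omega> \<in> V}"
      using UV by (auto simp: T)
    have "(\<lambda>\<omega>. \<epsilon> *\<^sub>R Z (T/\<epsilon>) \<omega>) \<in> borel_measurable (P (zz \<epsilon>))"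
      using l \<epsilon> z(1) by (intro borel_measurable_scaleR measurable_Z) (auto simp: T)
    from measurable_sets[OF this V]
    show "{\<omega>\<in>space N. \<epsilon> *\<^sub>R Z (T/\<epsilon>) \<omega> \<in> V} \<in> sets (P (zz \<epsilon>))"
      by (simp add: space_P[OF z(1)] vimage_def Int_def conj_commute)
  qed
  also note up
  finally have "-j/(l * \<epsilon>) < -c/\<epsilon>" by (simp add: ennreal_less_iff)
  then show ?thesis using l \<epsilon> by (simp add: field_simps)
qed

lemma emeasure_scaled_ball_le_rescaled:
  assumes t: "t \<ge> 0" and z: "z \<in> E" and c: "c > 0" and n: "n > 0"
    and r: "c * n * \<delta> + \<bar>c * n - l\<bar> * norm p \<le> r"
  shows "emeasure (P z) {\<omega>\<in>space N. Z t \<omega> \<in> (\<lambda>x. n *\<^sub>R x) ` ball p \<delta>}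
    \<le> emeasure (P z) {\<omega>\<in>space N. c *\<^sub>R Z t \<omega> \<in> cball (l *\<^sub>R p) r}"
proof (rule emeasure_mono)
  show "{\<omega>\<in>space N. Z t \<omega> \<in> (\<lambda>x. n *\<^sub>R x) ` ball p \<delta>} \<subseteq> {\<omega>\<in>space N. c *\<^sub>R Z t \<omega> \<in> cball (l *\<^sub>R p) r}"
  proof (intro subsetI CollectI conjI)
    fix \<omega> assume "\<omega> \<in> {\<omega>\<in>space N. Z t \<omega> \<in> (\<lambda>x. n *\<^sub>R x) ` ball p \<delta>}"
    then obtain x where "\<omega> \<in> space N" and x: "dist p x < \<delta>" "Z t \<omega> = n *\<^sub>R x" by auto
    then show "\<omega> \<in> space N" by simp
    have "norm ((c * n) *\<^sub>R x - l *\<^sub>R p) \<le> (c * n) * norm (x - 1 *\<^sub>R p) + \<bar>c * n - l\<bar> * norm p"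
      using norm_rescale_diff_le[of "c * n" x l p 1] c n by simp
    also have "\<dots> \<le> c * n * \<delta> + \<bar>c * n - l\<bar> * norm p"
      using x(1) c n by (intro add_right_mono mult_left_mono) (auto simp: dist_norm norm_minus_commute)
    also have "\<dots> \<le> r" by (rule r)
    finally show "c *\<^sub>R Z t \<omega> \<in> cball (l *\<^sub>R p) r" using x(2) by (simp add: dist_norm norm_minus_commute)
  qed
  have "Z t \<in> borel_measurable (P z)" using t z by (rule measurable_Z)
  then show "{\<omega>\<in>space N. c *\<^sub>R Z t \<omega> \<in> cball (l *\<^sub>R p) r} \<in> sets (P z)"
    unfolding space_P[OF z, symmetric] mem_cball by measurable
qed

end

locale ldp_markov_process = markov_process E N P Z
  for E :: "'a::euclidean_space set" and N :: "'w measure" and P Z +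
  fixes I :: "real \<Rightarrow> 'a \<Rightarrow> 'a \<Rightarrow> ennreal"
  assumes H1: "H1 E N P Z I"
begin

lemma large_time_bound:
  assumes pos: "\<exists>T>0. I T 0 0 > 0"
  obtains K \<beta> where "K > 0" "\<beta> > 0" "\<And>n \<delta> t z. 1 \<le> n \<Longrightarrow> \<delta> \<le> 1 \<Longrightarrow> K * n \<le> t \<Longrightarrow> z \<in> E \<Longrightarrow>
      norm (z - n *\<^sub>R q) < \<delta> * n \<Longrightarrow>
        emeasure (P z) {\<omega>\<in>space N. Z t \<omega> \<in> (\<lambda>x. n *\<^sub>R x) ` ball q' \<delta>} \<le> ennreal (exp (-(\<beta> * t)))"
proof -
  obtain \<kappa> \<rho> \<beta> t0 where \<kappa>\<rho>\<beta>: "\<kappa> > 0" "\<rho> > 0" "\<beta> > 0"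
    and escape: "\<And>t z. t > t0 \<Longrightarrow> z \<in> E \<Longrightarrow> norm z < \<kappa> * t \<Longrightarrow>
           emeasure (P z) {\<omega>\<in>space N. norm (Z t \<omega>) \<le> \<rho> * t} \<le> ennreal (exp (-(\<beta> * t)))"
    using escape_bound[OF H1 pos] by blast
  define K where "K = max (\<bar>t0\<bar> + 1) (max ((norm q + 1) / \<kappa>) ((norm q' + 1) / \<rho>))"
  have "\<bar>t0\<bar> + 1 \<le> K" "(norm q + 1) / \<kappa> \<le> K" "(norm q' + 1) / \<rho> \<le> K" by (auto simp: K_def)
  then have K: "K > 0" "t0 < K" "norm q + 1 \<le> \<kappa> * K" "norm q' + 1 \<le> \<rho> * K"
    using \<kappa>\<rho>\<beta> by (auto simp: pos_divide_le_eq mult.commute)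
  show ?thesis
  proof (rule that[OF K(1) \<kappa>\<rho>\<beta>(3)])
    fix n \<delta> t z assume n: "1 \<le> n" and \<delta>: "\<delta> \<le> 1" and t: "K * n \<le> t" and z: "z \<in> E"
      and nz: "norm (z - n *\<^sub>R q) < \<delta> * n"
    have "K \<le> K * n" using n K(1) by simp
    then have "t > t0" using t K(2) by simp
    have "norm z < n * (norm q + 1)" using norm_less_of_near_scaled[OF nz _ \<delta>] n by simp
    also have "\<dots> \<le> \<kappa> * (K * n)" using K(3) n by (simp add: mult_right_mono mult.commute mult.left_commute)
    also have "\<dots> \<le> \<kappa> * t" using t \<kappa>\<rho>\<beta>(1) by simp
    finally have zt: "norm z < \<kappa> * t" .
    have "n * (norm q' + 1) \<le> \<rho> * t"
      using K(4) n t \<kappa>\<rho>\<beta>(2) by (smt (verit, best) mult.commute mult.left_commute mult_left_mono mult_right_mono)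
    then have "{\<omega>\<in>space N. Z t \<omega> \<in> (\<lambda>x. n *\<^sub>R x) ` ball q' \<delta>} \<subseteq> {\<omega>\<in>space N. norm (Z t \<omega>) \<le> \<rho> * t}"
    proof (intro subsetI CollectI conjI)
      fix \<omega> assume "\<omega> \<in> {\<omega>\<in>space N. Z t \<omega> \<in> (\<lambda>x. n *\<^sub>R x) ` ball q' \<delta>}"
      then show "\<omega> \<in> space N" "norm (Z t \<omega>) \<le> \<rho> * t"
        using norm_le_of_mem_scaled_ball[of "Z t \<omega>" n q' \<delta>] \<delta> n \<open>n * (norm q' + 1) \<le> \<rho> * t\<close> by auto
    qed
    moreover have "Z t \<in> borel_measurable (P z)" using \<open>t > t0\<close> K t n
      by (intro measurable_Z z) (smt (verit) mult_nonneg_nonneg)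
    then have "{\<omega>\<in>space N. norm (Z t \<omega>) \<le> \<rho> * t} \<in> sets (P z)"
      unfolding space_P[OF z, symmetric] by measurable
    ultimately show "emeasure (P z) {\<omega>\<in>space N. Z t \<omega> \<in> (\<lambda>x. n *\<^sub>R x) ` ball q' \<delta>} \<le> ennreal (exp (-(\<beta> * t)))"
      using escape[OF \<open>t > t0\<close> z zt] by (meson emeasure_mono order_trans)
  qed
qed

(* At T = 1/l the events {\<epsilon> Z(T/\<epsilon>) \<in> V} and {l\<epsilon> Z(1/(l\<epsilon>)) \<in> U} concern the same time T/\<epsilon>:
   comparing the LDP upper bound for the first with the lower bound for the second forces the
   rate functions to scale. *)
lemma rate_scaling:
  assumes q: "q \<in> scaling_limits E" and l: "l > 0"
  shows "ennreal l * I (1/l) q q' \<le> I 1 (l *\<^sub>R q) (l *\<^sub>R q')"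
proof (rule ccontr)
  define T where "T = 1/l"
  have T: "T > 0" using l by (simp add: T_def)
  let ?J = "I 1 (l *\<^sub>R q) (l *\<^sub>R q')"
  assume "\<not> ennreal l * I (1/l) q q' \<le> ?J"
  then obtain j where j: "0 \<le> j" "?J < ennreal j" "ennreal j < ennreal l * I T q q'"
    using ennreal_dense_real[of ?J] unfolding T_def by (auto simp: not_le)
  have "ennreal (j/l) < I T q q'"
  proof (rule ccontr)
    assume "\<not> ennreal (j/l) < I T q q'"
    then have "ennreal l * I T q q' \<le> ennreal l * ennreal (j/l)" by (simp add: mult_left_mono)
    also have "\<dots> = ennreal j" using l j(1) by (simp add: ennreal_mult[symmetric])
    finally show False using j(3) by simp
  qed
  then obtain c where c: "0 \<le> c" "ennreal (j/l) < ennreal c" "ennreal c < I T q q'"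
    using ennreal_dense_real by blast
  moreover have "0 \<le> j/l" using j(1) l by simp
  ultimately have jc: "j/l < c" using ennreal_less_iff by blast
  obtain d where d: "d > 0" "\<And>p'. dist p' q' < d \<Longrightarrow> ennreal c < I T q p'"
    using lsc_gt_on_ball[OF H1_lsc[OF H1 T] c(3)] by blast
  define V where "V = cball q' (d/2)"
  define U where "U = ball (l *\<^sub>R q') (l * d/2)"
  define c' where "c' = (j/l + c)/2"
  have c': "c' < c" "j < l * c'" using jc l by (auto simp: c'_def field_simps)
  have "\<forall>q''\<in>V. ennreal c \<le> I T q q''" using d unfolding V_def by (auto intro!: less_imp_le simp: dist_commute)
  from H1_upper_eventually[OF H1 T _ this c'(1)]
  have upper: "\<forall>\<^sub>F \<delta> in at_right 0. \<forall>\<^sub>F \<epsilon> in at_right 0. \<forall>z\<in>E. norm (\<epsilon> *\<^sub>R z - q) < \<delta> \<longrightarrow>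
      emeasure (P z) {\<omega>\<in>space N. \<epsilon> *\<^sub>R Z (T/\<epsilon>) \<omega> \<in> V} \<le> ennreal (exp (-c'/\<epsilon>))"
    unfolding V_def by simp
  have "(INF q''\<in>U. I 1 (l *\<^sub>R q) q'') \<le> ?J" using l d by (intro INF_lower) (simp add: U_def)
  then have "(INF q''\<in>U. I 1 (l *\<^sub>R q) q'') < ennreal j" using j(2) by simp
  from H1_lower_eventually[OF H1 zero_less_one _ this]
  have lower: "\<forall>\<^sub>F \<delta> in at_right 0. \<forall>\<^sub>F \<epsilon> in at_right 0. \<forall>z\<in>E. norm (\<epsilon> *\<^sub>R z - l *\<^sub>R q) < \<delta> \<longrightarrow>
      ennreal (exp (-j/\<epsilon>)) < emeasure (P z) {\<omega>\<in>space N. \<epsilon> *\<^sub>R Z (1/\<epsilon>) \<omega> \<in> U}"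
    unfolding U_def by simp
  have "\<epsilon> *\<^sub>R x \<in> V" if "(l * \<epsilon>) *\<^sub>R x \<in> U" for \<epsilon> x
  proof -
    have "l *\<^sub>R q' - (l * \<epsilon>) *\<^sub>R x = l *\<^sub>R (q' - \<epsilon> *\<^sub>R x)" by (simp add: algebra_simps)
    then show ?thesis using l that by (simp add: U_def V_def dist_norm)
  qed
  moreover have "V \<in> sets borel" by (simp add: V_def borel_closed)
  ultimately have "l * c' < j" using nested_events_rate_less[OF q l T_def _ _ upper lower] by blast
  then show False using c'(2) by simp
qed

lemma scaled_rate_gt:
  assumes q: "q \<in> scaling_limits E" and l: "l > 0" and a: "ennreal a < rateI I q q'" and "a \<ge> 0"
  shows "ennreal (l * a) < I 1 (l *\<^sub>R q) (l *\<^sub>R q')"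
proof -
  have "rateI I q q' \<le> I (1/l) q q'" unfolding rateI_def using l by (intro INF_lower) auto
  have "ennreal (l * a) = ennreal l * ennreal a" using l \<open>a \<ge> 0\<close> by (simp add: ennreal_mult)
  also have "\<dots> < ennreal l * rateI I q q'" using l a by (intro ennreal_mult_strict_left_mono) auto
  also have "\<dots> \<le> ennreal l * I (1/l) q q'" by (intro mult_left_mono) (fact, simp)
  also have "\<dots> \<le> I 1 (l *\<^sub>R q) (l *\<^sub>R q')" by (rule rate_scaling[OF q l])
  finally show ?thesis .
qed

lemma middle_time_bound_local:
  assumes l: "l > 0" and a': "0 < a'" "a' < a" and la: "ennreal (l * a) < I 1 (l *\<^sub>R q) (l *\<^sub>R q')"
  shows "\<exists>w>0. \<forall>\<^sub>F \<delta> in at_right 0. \<forall>\<^sub>F n in at_top. \<forall>t z. 0 < t \<longrightarrow> \<bar>n/t - l\<bar> < w \<longrightarrow> z \<in> E \<longrightarrow>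
    norm (z - n *\<^sub>R q) < \<delta> * n \<longrightarrow>
      emeasure (P z) {\<omega>\<in>space N. Z t \<omega> \<in> (\<lambda>x. n *\<^sub>R x) ` ball q' \<delta>} \<le> ennreal (exp (-(a' * n)))"
proof -
  define b where "b = (a' + a) / 2"
  have b: "a' < b" "b < a" using a' by (auto simp: b_def)
  obtain r where r: "r > 0" "\<And>p'. dist p' (l *\<^sub>R q') < r \<Longrightarrow> ennreal (l * a) < I 1 (l *\<^sub>R q) p'"
    using lsc_gt_on_ball[OF H1_lsc[OF H1 zero_less_one] la] by blast
  define V where "V = cball (l *\<^sub>R q') (r/2)"
  have "\<forall>q''\<in>V. ennreal (l * a) \<le> I 1 (l *\<^sub>R q) q''"
    using r unfolding V_def by (auto intro!: less_imp_le simp: dist_commute)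
  from H1_upper_eventually[OF H1 zero_less_one _ this, of "l * b"] l b(2)
  obtain \<delta>l where \<delta>l: "\<delta>l > 0" and "\<forall>\<^sub>F \<epsilon> in at_right 0. \<forall>z\<in>E. norm (\<epsilon> *\<^sub>R z - l *\<^sub>R q) < \<delta>l \<longrightarrow>
      emeasure (P z) {\<omega>\<in>space N. \<epsilon> *\<^sub>R Z (1/\<epsilon>) \<omega> \<in> V} \<le> ennreal (exp (-(l * b)/\<epsilon>))"
    unfolding V_def by (auto elim: eventually_at_right_0_obtain)
  then obtain e where e: "e > 0" "\<And>\<epsilon> z. 0 < \<epsilon> \<Longrightarrow> \<epsilon> < e \<Longrightarrow> z \<in> E \<Longrightarrow> norm (\<epsilon> *\<^sub>R z - l *\<^sub>R q) < \<delta>l \<Longrightarrow>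
      emeasure (P z) {\<omega>\<in>space N. \<epsilon> *\<^sub>R Z (1/\<epsilon>) \<omega> \<in> V} \<le> ennreal (exp (-(l * b)/\<epsilon>))"
    unfolding eventually_at_right_field by auto
  (* w and ds keep the rescaled start within \<delta>l of l q and the rescaled target ball inside V,
     and w keeps a' l' below l b. *)
  define w where "w = min (l/2) (min (\<delta>l / (2 * (norm q + 1))) (min (r / (4 * (norm q' + 1))) (l * (b/a' - 1))))"
  have wle: "w \<le> l/2" "w \<le> \<delta>l / (2 * (norm q + 1))" "w \<le> r / (4 * (norm q' + 1))" "w \<le> l * (b/a' - 1)"
    unfolding w_def by (rule min.cobounded1, (intro min.coboundedI2 min.cobounded1)+, intro min.coboundedI2 order_refl)
  have "b/a' - 1 > 0" using a' b by (simp add: field_simps)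
  then have "w > 0" using \<delta>l r l unfolding w_def by (simp add: add_nonneg_pos)
  moreover have "w * norm q \<le> \<delta>l/2" "w * norm q' \<le> r/4"
  proof -
    have nq: "0 < 2 * (norm q + 1)" "0 < 4 * (norm q' + 1)" by (auto intro: add_nonneg_pos)
    have "w * (2 * (norm q + 1)) \<le> \<delta>l" "w * (4 * (norm q' + 1)) \<le> r"
      using wle(2,3) nq by (simp_all add: pos_le_divide_eq)
    then show "w * norm q \<le> \<delta>l/2" "w * norm q' \<le> r/4"
      using \<open>w > 0\<close> by (simp_all add: algebra_simps)
  qed
  moreover have "l + w \<le> l * b / a'" using wle(4) a' by (simp add: field_simps)
  ultimately have w: "w > 0" "w \<le> l/2" "w * norm q \<le> \<delta>l/2" "w * norm q' \<le> r/4" "l + w \<le> l * b / a'"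
    using wle(1) by auto
  define ds where "ds = min (\<delta>l / (4 * l)) (r / (8 * l))"
  have "ds \<le> \<delta>l / (4 * l)" "ds \<le> r / (8 * l)" unfolding ds_def by (rule min.cobounded1, rule min.cobounded2)
  then have "ds * (4 * l) \<le> \<delta>l" "ds * (8 * l) \<le> r" using l by (simp_all add: pos_le_divide_eq)
  then have ds: "ds > 0" "2 * l * ds \<le> \<delta>l/2" "2 * l * ds \<le> r/4"
    using \<delta>l r l by (simp_all add: ds_def algebra_simps)
  have "\<forall>\<^sub>F \<delta> in at_right 0. \<delta> < ds" using ds(1) eventually_at_right_field by blast
  moreover have "\<forall>\<^sub>F n in at_top. 2 * l / e < n" by (rule eventually_gt_at_top)
  ultimately show ?thesis
  proof (intro exI[of _ w] conjI w(1), elim eventually_mono, intro allI impI)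
    fix \<delta> n t z assume \<delta>: "\<delta> < ds" and n: "2 * l / e < n" and t: "0 < t" and l': "\<bar>n/t - l\<bar> < w"
      and z: "z \<in> E" and nz: "norm (z - n *\<^sub>R q) < \<delta> * n"
    define l' where "l' = n/t"
    have n0: "n > 0" using n l e(1) by (smt (verit) divide_pos_pos)
    have l'w: "\<bar>l' - l\<bar> < w" using l' by (simp add: l'_def)
    then have l'0: "l' > 0" "l' \<le> 2 * l" using w(2) by auto
    define \<epsilon> where "\<epsilon> = 1/t"
    have \<epsilon>: "\<epsilon> > 0" "\<epsilon> * n = l'" "1/\<epsilon> = t" using t by (auto simp: \<epsilon>_def l'_def)
    have "2 * l < e * n" using n e(1) by (simp add: field_simps)
    then have "\<epsilon> * n < e * n" using l'0 \<epsilon>(2) by simp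
    then have "\<epsilon> < e" using n0 by (simp add: mult_less_cancel_right)
    have "0 < \<delta> * n" using nz norm_ge_zero[of "z - n *\<^sub>R q"] by linarith
    then have "\<delta> > 0" using n0 by (simp add: zero_less_mult_iff)
    then have "l' * \<delta> \<le> 2 * l * ds" using l'0 \<delta> l by (intro mult_mono) auto
    have "norm (\<epsilon> *\<^sub>R z - l *\<^sub>R q) \<le> \<epsilon> * norm (z - n *\<^sub>R q) + \<bar>l' - l\<bar> * norm q"
      using norm_rescale_diff_le[OF \<epsilon>(1), of z l q n] \<epsilon>(2) by simp
    also have "\<dots> < l' * \<delta> + w * norm q"
    proof -
      have "\<epsilon> * (\<delta> * n) = l' * \<delta>" by (simp add: \<epsilon>(2)[symmetric] mult_ac)
      then have "\<epsilon> * norm (z - n *\<^sub>R q) < l' * \<delta>" using mult_strict_left_mono[OF nz \<epsilon>(1)] by argo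
      moreover have "\<bar>l' - l\<bar> * norm q \<le> w * norm q" using l'w by (intro mult_right_mono) auto
      ultimately show ?thesis by (rule add_less_le_mono)
    qed
    also have "\<dots> \<le> \<delta>l" using \<open>l' * \<delta> \<le> 2 * l * ds\<close> ds(2) w(3) by simp
    finally have up: "emeasure (P z) {\<omega>\<in>space N. \<epsilon> *\<^sub>R Z t \<omega> \<in> V} \<le> ennreal (exp (-(l * b)/\<epsilon>))"
      using e(2)[OF \<epsilon>(1) \<open>\<epsilon> < e\<close> z] \<epsilon>(3) by simp
    have "\<epsilon> * n * \<delta> + \<bar>\<epsilon> * n - l\<bar> * norm q' \<le> r/2"
      using \<open>l' * \<delta> \<le> 2 * l * ds\<close> ds(3) w(4) l'w \<epsilon>(2) mult_right_mono[of "\<bar>l' - l\<bar>" w "norm q'"] by simp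
    then have "emeasure (P z) {\<omega>\<in>space N. Z t \<omega> \<in> (\<lambda>x. n *\<^sub>R x) ` ball q' \<delta>}
        \<le> emeasure (P z) {\<omega>\<in>space N. \<epsilon> *\<^sub>R Z t \<omega> \<in> V}"
      unfolding V_def using t z \<epsilon>(1) n0 by (intro emeasure_scaled_ball_le_rescaled) auto
    moreover have "a' * n \<le> l * b / \<epsilon>"
    proof -
      have "l' \<le> l + w" using l'w by linarith
      then have "a' * l' \<le> a' * (l + w)" using a' by (intro mult_left_mono) auto
      also have "\<dots> \<le> l * b" using w(5) a' by (simp add: field_simps)
      finally have "a' * l' \<le> l * b" .
      then have "a' * l' * (n / l') \<le> l * b * (n / l')" using l'0 n0 by (intro mult_right_mono) auto
      moreover have "\<epsilon> = l' / n" using \<epsilon>(2) n0 by (simp add: eq_divide_eq)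
      ultimately show ?thesis using l'0 by simp
    qed
    then have "exp (-(l * b)/\<epsilon>) \<le> exp (-(a' * n))" by simp
    ultimately show "emeasure (P z) {\<omega>\<in>space N. Z t \<omega> \<in> (\<lambda>x. n *\<^sub>R x) ` ball q' \<delta>} \<le> ennreal (exp (-(a' * n)))"
      using up by (meson ennreal_leI order_trans)
  qed
qed

lemma middle_time_bound:
  assumes L0: "0 < L0" and a': "0 < a'" "a' < a"
    and la: "\<And>l. l \<in> {L0..L1} \<Longrightarrow> ennreal (l * a) < I 1 (l *\<^sub>R q) (l *\<^sub>R q')"
  shows "\<forall>\<^sub>F \<delta> in at_right 0. \<forall>\<^sub>F n in at_top. \<forall>t z. 0 < t \<longrightarrow> n/t \<in> {L0..L1} \<longrightarrow> z \<in> E \<longrightarrow>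
    norm (z - n *\<^sub>R q) < \<delta> * n \<longrightarrow>
      emeasure (P z) {\<omega>\<in>space N. Z t \<omega> \<in> (\<lambda>x. n *\<^sub>R x) ` ball q' \<delta>} \<le> ennreal (exp (-(a' * n)))"
proof -
  define bound where "bound l w \<delta> n \<longleftrightarrow> (\<forall>t z. 0 < t \<longrightarrow> \<bar>n/t - l\<bar> < w \<longrightarrow> z \<in> E \<longrightarrow>
    norm (z - n *\<^sub>R q) < \<delta> * n \<longrightarrow>
      emeasure (P z) {\<omega>\<in>space N. Z t \<omega> \<in> (\<lambda>x. n *\<^sub>R x) ` ball q' \<delta>} \<le> ennreal (exp (-(a' * n))))"
    for l w \<delta> n
  have "\<forall>l\<in>{L0..L1}. \<exists>w>0. \<forall>\<^sub>F \<delta> in at_right 0. \<forall>\<^sub>F n in at_top. bound l w \<delta> n"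
    using middle_time_bound_local[OF _ a' la] L0 unfolding bound_def by auto
  then obtain W where W: "\<forall>l\<in>{L0..L1}. W l > 0 \<and> (\<forall>\<^sub>F \<delta> in at_right 0. \<forall>\<^sub>F n in at_top. bound l (W l) \<delta> n)"
    by metis
  then have "{L0..L1} \<subseteq> (\<Union>l\<in>{L0..L1}. ball l (W l))" by force
  then obtain C where C: "C \<subseteq> {L0..L1}" "finite C" "{L0..L1} \<subseteq> (\<Union>c\<in>C. ball c (W c))"
    using compactE_image[OF compact_Icc, of "{L0..L1}" "\<lambda>c. ball c (W c)"] by blast
  have "\<forall>c\<in>C. \<forall>\<^sub>F \<delta> in at_right 0. \<forall>\<^sub>F n in at_top. bound c (W c) \<delta> n" using W C(1) by blast
  then have "\<forall>\<^sub>F \<delta> in at_right 0. \<forall>c\<in>C. \<forall>\<^sub>F n in at_top. bound c (W c) \<delta> n"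
    by (rule eventually_ball_finite[OF C(2)])
  then have "\<forall>\<^sub>F \<delta> in at_right 0. \<forall>\<^sub>F n in at_top. \<forall>c\<in>C. bound c (W c) \<delta> n"
    by (rule eventually_mono) (rule eventually_ball_finite[OF C(2)])
  then show ?thesis
  proof (rule eventually_mono, elim eventually_mono, intro allI impI)
    fix \<delta> n t z assume B: "\<forall>c\<in>C. bound c (W c) \<delta> n" and "0 < t" "n/t \<in> {L0..L1}" "z \<in> E"
      "norm (z - n *\<^sub>R q) < \<delta> * n"
    moreover obtain c where "c \<in> C" "n/t \<in> ball c (W c)" using C(3) \<open>n/t \<in> {L0..L1}\<close> by blast
    ultimately show "emeasure (P z) {\<omega>\<in>space N. Z t \<omega> \<in> (\<lambda>x. n *\<^sub>R x) ` ball q' \<delta>} \<le> ennreal (exp (-(a' * n)))"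
      unfolding bound_def by (auto simp: dist_real_def abs_minus_commute)
  qed
qed

section \<open>Decay of the Green function\<close>

lemma Limsup_log_green_le_pos:
  assumes pos: "\<exists>T>0. I T 0 0 > 0" and c: "c > 0"
  shows "Limsup (at_right 0) (\<lambda>\<delta>::real. Limsup at_top (\<lambda>n::real.
           SUP z\<in>{z\<in>E. norm (z - n *\<^sub>R q) < \<delta> * n}.
             ereal (1 / n) * elog (green N P Z z ((\<lambda>x. n *\<^sub>R x) ` ball q' \<delta>)))) \<le> ereal c"
proof -
  obtain K \<beta> where K: "K > 0" and \<beta>: "\<beta> > 0" and large: "\<And>n \<delta> t z. 1 \<le> n \<Longrightarrow> \<delta> \<le> 1 \<Longrightarrow>
      K * n \<le> t \<Longrightarrow> z \<in> E \<Longrightarrow> norm (z - n *\<^sub>R q) < \<delta> * n \<Longrightarrow>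
        emeasure (P z) {\<omega>\<in>space N. Z t \<omega> \<in> (\<lambda>x. n *\<^sub>R x) ` ball q' \<delta>} \<le> ennreal (exp (-(\<beta> * t)))"
    using large_time_bound[OF pos] by blast
  have "\<forall>\<^sub>F \<delta> in at_right 0. \<forall>\<^sub>F n in at_top. \<forall>z\<in>{z\<in>E. norm (z - n *\<^sub>R q) < \<delta> * n}. \<forall>t\<ge>0.
      emeasure (P z) {\<omega>\<in>space N. Z t \<omega> \<in> (\<lambda>x. n *\<^sub>R x) ` ball q' \<delta>}
        \<le> ennreal (if t \<le> K * n then 1 * exp (-(0*n)) else exp (-(0*n)) * exp (-(\<beta>*t)))"
    unfolding eventually_at_right_field
  proof (intro exI[of _ 1] conjI allI impI)
    fix \<delta> :: real assume "0 < \<delta>" "\<delta> < 1"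
    show "\<forall>\<^sub>F n in at_top. \<forall>z\<in>{z\<in>E. norm (z - n *\<^sub>R q) < \<delta> * n}. \<forall>t\<ge>0.
      emeasure (P z) {\<omega>\<in>space N. Z t \<omega> \<in> (\<lambda>x. n *\<^sub>R x) ` ball q' \<delta>}
        \<le> ennreal (if t \<le> K * n then 1 * exp (-(0*n)) else exp (-(0*n)) * exp (-(\<beta>*t)))"
      using eventually_ge_at_top[of 1]
    proof eventually_elim
      case (elim n)
      then show ?case
        using large[OF elim] \<open>\<delta> < 1\<close> prob_space.emeasure_le_1[OF prob_space_P] by auto
    qed
  qed simp
  then show ?thesis
    using Limsup_green_le[OF \<beta> zero_less_one K, of "-c" 0] c by simp
qed

lemma Limsup_log_green_le_rate:
  assumes h2: "H2 E P Z" and pos: "\<exists>T>0. I T 0 0 > 0" and q: "q \<in> scaling_limits E" and "q \<noteq> q'"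
    and \<alpha>: "0 \<le> \<alpha>" "ennreal \<alpha> < rateI I q q'"
  shows "Limsup (at_right 0) (\<lambda>\<delta>::real. Limsup at_top (\<lambda>n::real.
           SUP z\<in>{z\<in>E. norm (z - n *\<^sub>R q) < \<delta> * n}.
             ereal (1 / n) * elog (green N P Z z ((\<lambda>x. n *\<^sub>R x) ` ball q' \<delta>)))) \<le> ereal (-\<alpha>)"
proof -
  obtain a where a: "0 \<le> a" "ennreal \<alpha> < ennreal a" "ennreal a < rateI I q q'"
    using ennreal_dense_real[OF \<alpha>(2)] by blast
  then have "\<alpha> < a" using \<alpha>(1) ennreal_less_iff by blast
  define a1 where "a1 = (\<alpha> + a) / 2"
  have a1: "\<alpha> < a1" "a1 < a" "0 < a1" using \<open>\<alpha> < a\<close> \<alpha>(1) by (auto simp: a1_def)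
  obtain K0 \<beta> where "K0 > 0" "\<beta> > 0" and large: "\<And>n \<delta> t z. 1 \<le> n \<Longrightarrow> \<delta> \<le> 1 \<Longrightarrow>
      K0 * n \<le> t \<Longrightarrow> z \<in> E \<Longrightarrow> norm (z - n *\<^sub>R q) < \<delta> * n \<Longrightarrow>
        emeasure (P z) {\<omega>\<in>space N. Z t \<omega> \<in> (\<lambda>x. n *\<^sub>R x) ` ball q' \<delta>} \<le> ennreal (exp (-(\<beta> * t)))"
    using large_time_bound[OF pos] by blast
  have "norm (q' - q) > 0" using \<open>q \<noteq> q'\<close> by simp
  obtain s Cs where "s > 0" "Cs > 0" and small: "\<And>n \<delta> t z. n > 0 \<Longrightarrow> \<delta> \<le> norm (q' - q) / 4 \<Longrightarrow>
      0 \<le> t \<Longrightarrow> t \<le> s * n \<Longrightarrow> z \<in> E \<Longrightarrow> norm (z - n *\<^sub>R q) < \<delta> * n \<Longrightarrow>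
        emeasure (P z) {\<omega>\<in>space N. Z t \<omega> \<in> (\<lambda>x. n *\<^sub>R x) ` ball q' \<delta>} \<le> ennreal (Cs * exp (-(a1 * n)))"
    using small_time_bound[OF h2 \<open>norm (q' - q) > 0\<close> less_imp_le[OF a1(3)]] by blast
  define K where "K = max K0 (max s (2 * a1 / \<beta>))"
  have "K0 \<le> K" "s \<le> K" "2 * a1 / \<beta> \<le> K" by (auto simp: K_def)
  then have K: "K0 \<le> K" "s \<le> K" "a1 \<le> \<beta> * K / 2" "K > 0"
    using \<open>\<beta> > 0\<close> \<open>s > 0\<close> by (auto simp: pos_divide_le_eq mult.commute)
  have "\<forall>\<^sub>F \<delta> in at_right 0. \<forall>\<^sub>F n in at_top. \<forall>t z. 0 < t \<longrightarrow> n/t \<in> {1/K..1/s} \<longrightarrow> z \<in> E \<longrightarrow>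
      norm (z - n *\<^sub>R q) < \<delta> * n \<longrightarrow>
        emeasure (P z) {\<omega>\<in>space N. Z t \<omega> \<in> (\<lambda>x. n *\<^sub>R x) ` ball q' \<delta>} \<le> ennreal (exp (-(a1 * n)))"
    using K(4) a1 a by (intro middle_time_bound scaled_rate_gt[OF q]) (auto intro: less_le_trans[of 0 "1/K"])
  moreover have "\<forall>\<^sub>F \<delta> in at_right 0. \<delta> < min 1 (norm (q' - q) / 4)"
    unfolding eventually_at_right_field using \<open>norm (q' - q) > 0\<close>
    by (intro exI[of _ "min 1 (norm (q' - q) / 4)"]) auto
  ultimately have "\<forall>\<^sub>F \<delta> in at_right 0. \<forall>\<^sub>F n in at_top. \<forall>z\<in>{z\<in>E. norm (z - n *\<^sub>R q) < \<delta> * n}. \<forall>t\<ge>0.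
      emeasure (P z) {\<omega>\<in>space N. Z t \<omega> \<in> (\<lambda>x. n *\<^sub>R x) ` ball q' \<delta>}
        \<le> ennreal (if t \<le> K * n then (Cs + 1) * exp (-(a1*n)) else exp (-(a1*n)) * exp (-(\<beta>/2 * t)))"
  proof eventually_elim
    case (elim \<delta>)
    from elim(1) eventually_ge_at_top[of 1] show ?case
    proof eventually_elim
      case (elim n)
      show ?case
      proof (intro ballI allI impI)
        fix z and t :: real assume z: "z \<in> {z\<in>E. norm (z - n *\<^sub>R q) < \<delta> * n}" and t: "0 \<le> t"
        let ?p = "emeasure (P z) {\<omega>\<in>space N. Z t \<omega> \<in> (\<lambda>x. n *\<^sub>R x) ` ball q' \<delta>}"
        consider "t \<le> s * n" | "s * n < t" "t \<le> K * n" | "K * n < t" by linarith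
        then show "?p \<le> ennreal (if t \<le> K * n then (Cs + 1) * exp (-(a1*n)) else exp (-(a1*n)) * exp (-(\<beta>/2 * t)))"
        proof cases
          case 1
          moreover have "s * n \<le> K * n" using K(2) elim(2) by (intro mult_right_mono) auto
          ultimately have "t \<le> K * n" by linarith
          have "?p \<le> ennreal (Cs * exp (-(a1 * n)))" using small[OF _ _ t 1] z elim(2) \<open>\<delta> < _\<close> by auto
          also have "\<dots> \<le> ennreal ((Cs + 1) * exp (-(a1 * n)))" by (intro ennreal_leI mult_right_mono) auto
          finally show ?thesis using \<open>t \<le> K * n\<close> by simp
        next
          case 2
          have "0 < s * n" using \<open>s > 0\<close> elim(2) by simp
          then have "0 < t" using 2 by linarith
          then have "n/t \<in> {1/K..1/s}" using 2 \<open>s > 0\<close> K(4) by (auto simp: field_simps)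
          then have "?p \<le> ennreal (exp (-(a1 * n)))" using elim(1) z \<open>0 < t\<close> by auto
          also have "\<dots> \<le> ennreal ((Cs + 1) * exp (-(a1 * n)))" using \<open>Cs > 0\<close> by (intro ennreal_leI) simp
          finally show ?thesis using 2 by simp
        next
          case 3
          have "K0 * n \<le> K * n" using K(1) elim(2) by (intro mult_right_mono) auto
          then have "?p \<le> ennreal (exp (-(\<beta> * t)))"
            using large[OF elim(2) _ _ _] z 3 \<open>\<delta> < _\<close> by auto
          also have "\<dots> \<le> ennreal (exp (-(a1*n)) * exp (-(\<beta>/2 * t)))"
          proof (rule ennreal_leI)
            have "a1 * n \<le> \<beta> / 2 * (K * n)" using K(3) elim(2) mult_right_mono[of a1 "\<beta> * K / 2" n] by simp
            also have "\<dots> \<le> \<beta> / 2 * t" using 3 \<open>\<beta> > 0\<close> by (intro mult_left_mono) auto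
            finally have "a1 * n \<le> \<beta> / 2 * t" .
            then show "exp (-(\<beta> * t)) \<le> exp (-(a1*n)) * exp (-(\<beta>/2 * t))" by (simp add: exp_add[symmetric])
          qed
          finally show ?thesis using 3 by simp
        qed
      qed
    qed
  qed
  then show ?thesis
    using Limsup_green_le[of "\<beta>/2" "Cs + 1" K \<alpha> a1] \<open>\<beta> > 0\<close> \<open>Cs > 0\<close> K(4) a1(1) by simp
qed

end

theorem mainTheorem9:
  fixes E :: "'a::euclidean_space set" and N :: "'w measure" and P :: "'a \<Rightarrow> 'w measure"
    and Z :: "real \<Rightarrow> 'w \<Rightarrow> 'a" and I :: "real \<Rightarrow> 'a \<Rightarrow> 'a \<Rightarrow> ennreal"
    and q q' :: 'a
  assumes unbdd: "\<not> bounded E"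
    and markov: "strong_markov_cadlag E N P Z"
    and green_fin: "\<forall>z\<in>E. \<forall>B. compact B \<longrightarrow> green N P Z z B < \<infinity>"
    and h1: "H1 E N P Z I"
    and h2: "H2 E P Z"
    and pos: "\<exists>T>0. I T 0 0 > 0"
    and q: "q \<in> scaling_limits E" and q': "q' \<in> scaling_limits E"
  shows "Limsup (at_right 0) (\<lambda>\<delta>::real. Limsup at_top (\<lambda>n::real.
           SUP z\<in>{z\<in>E. norm (z - n *\<^sub>R q) < \<delta> * n}.
             ereal (1 / n) * elog (green N P Z z ((\<lambda>x. n *\<^sub>R x) ` ball q' \<delta>))))
         \<le> - enn2ereal (rateI_hat I q q')"
proof (rule ereal_le_uminus_if_forall_less)
  interpret ldp_markov_process E N P Z I
    using markov h1 by (simp add: ldp_markov_process_def markov_process_def ldp_markov_process_axioms_def)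
  fix \<alpha> assume \<alpha>: "ereal \<alpha> < enn2ereal (rateI_hat I q q')"
  show "Limsup (at_right 0) (\<lambda>\<delta>::real. Limsup at_top (\<lambda>n::real.
           SUP z\<in>{z\<in>E. norm (z - n *\<^sub>R q) < \<delta> * n}.
             ereal (1 / n) * elog (green N P Z z ((\<lambda>x. n *\<^sub>R x) ` ball q' \<delta>)))) \<le> ereal (-\<alpha>)"
  proof (cases "\<alpha> < 0")
    case True
    then show ?thesis using Limsup_log_green_le_pos[OF pos, of "-\<alpha>"] by simp
  next
    case False
    then have "q \<noteq> q'" using \<alpha> by (auto simp: rateI_hat_def zero_ennreal.rep_eq)
    moreover have "ennreal \<alpha> < rateI I q q'"
      using \<alpha> False \<open>q \<noteq> q'\<close> by (simp add: rateI_hat_def less_ennreal.rep_eq)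
    ultimately show ?thesis using Limsup_log_green_le_rate[OF h2 pos q] False by simp
  qed
qed

end
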